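(* Let $1<p<\infty$ and let $\mathcal{C}$ be the operator defined by $$\mathcal{C}(f)(z)=\frac{1}{z}\int_{0}^{z}f(\zeta)\,d\zeta,\qquad f\in H^{p}(\mathbb{U}),\ z\in\mathbb{U}.$$ Then $\mathcal{C}:H^p(\mathbb{U})\to H^p(\mathbb{U})$ is bounded. Further, its operator norm is $$\Vert\mathcal{C}\Vert=\frac{p}{p-1},$$ and its spectrum is $$\sigma(\mathcal{C})=\Bigl\{w\in\mathbb{C}:\Bigl|w-\frac{p}{2(p-1)}\Bigr|=\frac{p}{2(p-1)}\Bigr\}.$$
   Context: $\mathbb{U}=\{z\in\mathbb{C}:\mathrm{Im}(z)>0\}$ is the upper half-plane. For $0<p<\infty$, the Hardy space $H^p(\mathbb{U})$ is the space of analytic functions $f:\mathbb{U}\to\mathbb{C}$ with $$\Vert f\Vert_p=\sup_{y>0}\Bigl(\int_{-\infty}^{\infty}|f(x+iy)|^p\,dx\Bigr)^{1/p}<\infty ;$$ it is a complex Banach space for $1\le p<\infty$. In the definition of $\mathcal{C}$, the integral $\int_0^z f(\zeta)\,d\zeta$ is taken along the line segment $[0,z]$ from $0$ to $z$ (as an improper integral at the endpoint $0$). $\sigma(A)$ denotes the spectrum of an operator $A$ on $H^p(\mathbb{U})$. *)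

theory Defs
  imports "HOL-Complex_Analysis.Complex_Analysis"
begin

definition upper_half_plane :: "complex set" where
  "upper_half_plane = {z. Im z > 0}"

definition hardy_mean :: "real \<Rightarrow> (complex \<Rightarrow> complex) \<Rightarrow> real \<Rightarrow> real" where
  "hardy_mean p f y = (LINT x|lborel. norm (f (Complex x y)) powr p) powr (1 / p)"

text \<open>
  A function on the upper half-plane is represented by its extension by 0 to all of
  \<open>complex\<close>, so that equality of elements of the space is equality of HOL functions and the
  vector space operations are pointwise. The two last conditions together say that the
  supremum in \<open>hardy_norm\<close> is finite: the integral \<open>LINT\<close> is 0 for a non-integrable
  function, so integrability on each horizontal line is required separately.
\<close>

definition hardy_space :: "real \<Rightarrow> (complex \<Rightarrow> complex) set" where
  "hardy_space p = {f. f holomorphic_on upper_half_plane \<and>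
     (\<forall>z. z \<notin> upper_half_plane \<longrightarrow> f z = 0) \<and>
     (\<forall>y>0. integrable lborel (\<lambda>x. norm (f (Complex x y)) powr p)) \<and>
     bdd_above (hardy_mean p f ` {0<..})}"

definition hardy_norm :: "real \<Rightarrow> (complex \<Rightarrow> complex) \<Rightarrow> real" where
  "hardy_norm p f = (SUP y\<in>{0<..}. hardy_mean p f y)"

text \<open>
  The Hardy space depends on the real parameter \<open>p\<close> and so is not a type. The operator notions
  are therefore stated for a complex normed space of functions given by a carrier \<open>V\<close> and
  a norm \<open>N\<close>; values of operators outside \<open>V\<close> are irrelevant.
\<close>

definition bounded_operator_on ::
    "('a \<Rightarrow> complex) set \<Rightarrow> (('a \<Rightarrow> complex) \<Rightarrow> real) \<Rightarrow>
     (('a \<Rightarrow> complex) \<Rightarrow> ('a \<Rightarrow> complex)) \<Rightarrow> bool" where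
  "bounded_operator_on V N T \<longleftrightarrow>
     (\<forall>f\<in>V. T f \<in> V) \<and>
     (\<forall>f\<in>V. \<forall>g\<in>V. T (\<lambda>z. f z + g z) = (\<lambda>z. T f z + T g z)) \<and>
     (\<forall>c. \<forall>f\<in>V. T (\<lambda>z. c * f z) = (\<lambda>z. c * T f z)) \<and>
     (\<exists>K. \<forall>f\<in>V. N (T f) \<le> K * N f)"

definition operator_norm_on ::
    "('a \<Rightarrow> complex) set \<Rightarrow> (('a \<Rightarrow> complex) \<Rightarrow> real) \<Rightarrow>
     (('a \<Rightarrow> complex) \<Rightarrow> ('a \<Rightarrow> complex)) \<Rightarrow> real" where
  "operator_norm_on V N T = (SUP f\<in>{f \<in> V. N f \<le> 1}. N (T f))"

definition spectrum_on ::
    "('a \<Rightarrow> complex) set \<Rightarrow> (('a \<Rightarrow> complex) \<Rightarrow> real) \<Rightarrow>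
     (('a \<Rightarrow> complex) \<Rightarrow> ('a \<Rightarrow> complex)) \<Rightarrow> complex set" where
  "spectrum_on V N T = {w. \<not> (\<exists>S. bounded_operator_on V N S \<and>
     (\<forall>f\<in>V. S (\<lambda>z. w * f z - T f z) = f) \<and>
     (\<forall>f\<in>V. (\<lambda>z. w * S f z - T (S f) z) = f))}"

definition truncated_integral :: "(complex \<Rightarrow> complex) \<Rightarrow> complex \<Rightarrow> real \<Rightarrow> complex" where
  "truncated_integral f z e = contour_integral (linepath (of_real e * z) z) f"

text \<open>\<open>Lim\<close> is a definite description, unspecified where the improper integral diverges.\<close>

definition cesaro :: "(complex \<Rightarrow> complex) \<Rightarrow> complex \<Rightarrow> complex" where
  "cesaro f z = (if z \<in> upper_half_plane
     then 1 / z * Lim (at_right 0) (truncated_integral f z) else 0)"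

end

theory Submission
  imports Defs
begin

text \<open>
  Substituting \<open>\<zeta> = s z\<close> turns the Cesaro operator into an average of dilations,
  \<open>C f z = \<integral>\<^sub>0\<^sup>1 f (s z) ds\<close>. The dilation \<open>f \<mapsto> f (s \<cdot>)\<close> multiplies the Hardy norm by
  \<open>s\<close> to the power \<open>- 1 / p\<close>, so any average \<open>H\<^sub>k f z = \<integral> k s * f (s z) ds\<close> has norm at most
  \<open>\<integral> \<bar>k s\<bar> s\<^bsup>-1/p\<^esup> ds\<close>. This is \<open>hausdorff_op_bounded\<close>, and for \<open>C\<close> it gives the bound
  \<open>p / (p - 1)\<close>. Two such averages commute by Fubini (\<open>hausdorff_op_commute\<close>). The integrals
  converge because functions in the space satisfy \<open>\<bar>f z\<bar> \<le> const * (Im z)\<^bsup>-1/p\<^esup>\<close>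
  (\<open>hardy_space_pointwise_bound\<close>).

  The inverse of \<open>C\<close> is the differential expression \<open>f \<mapsto> (z f)'\<close>: whenever \<open>G\<close> lies in the space
  and \<open>f\<close> is the derivative of \<open>z G\<close>, the function \<open>G\<close> is the Cesaro average of \<open>f\<close>
  (\<open>cesaro_eqI\<close>). The formal eigenfunctions of \<open>f \<mapsto> (z f)'\<close> are the
  powers \<open>z\<^sup>a\<close>, with eigenvalue \<open>1 + a\<close>. Their
  size is comparable to \<open>\<bar>z\<bar>\<^bsup>Re a\<^esup>\<close>, which just fails to be in the space when
  \<open>Re a = - 1 / p\<close>. This is why the spectrum consists of the \<open>w\<close> with \<open>Re (1 / w) = 1 - 1 / p\<close>
  together with \<open>0\<close>, which is the circle of the theorem.

  Off the circle, put \<open>b = 1 / w\<close>. Solving the ordinary differential equation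
  \<open>z F' + (1 - b) F = f\<close> along rays gives \<open>F = H\<^sub>k f\<close>, where \<open>k s = s\<^bsup>-b\<^esup>\<close> on \<open>(0, 1]\<close> or
  \<open>k s = - s\<^bsup>-b\<^esup>\<close> on \<open>(1, \<infinity>)\<close>; exactly one of these kernels is integrable against
  \<open>s\<^bsup>-1/p\<^esup>\<close>, according to the sign of \<open>1 - 1 / p - Re b\<close>. The resolvent is then
  \<open>f \<mapsto> b f + b\<^sup>2 F\<close> (\<open>not_in_spectrum_cesaro\<close>).

  On the circle, \<open>z\<^sup>a\<close> is damped to \<open>g = z\<^bsup>a+\<epsilon>\<^esup> (z + \<i>)\<^bsup>-2\<epsilon>\<^esup>\<close>, which lies in the space and satisfies
  \<open>(z g)' = (1 + a) g + \<epsilon> m g\<close> with the multiplier \<open>m = (\<i> - z) / (z + \<i>)\<close>, bounded by \<open>1\<close> on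
  the half-plane. So \<open>h = (z g)'\<close> satisfies \<open>C h = g\<close> and differs from \<open>(1 + a) g\<close> by at most
  \<open>\<epsilon> \<bar>g\<bar>\<close> pointwise (\<open>cesaro_approximate_eigenfunction\<close>). This excludes a bounded inverse of
  \<open>w - C\<close>, and for \<open>a = - 1 / p\<close> it shows that the norm bound \<open>p / (p - 1)\<close> is attained in the
  limit \<open>\<epsilon> \<rightarrow> 0\<close>.
\<close>

section \<open>A weighted power mean inequality\<close>

lemma powr_tangent_le:
  fixes p m x :: real
  assumes "1 \<le> p" "0 < m" "0 \<le> x"
  shows "m powr p + p * m powr (p - 1) * (x - m) \<le> x powr p"
proof (cases "x = 0")
  case True
  have eq: "m powr (p - 1) * m = m powr p"
    using assms by (simp add: powr_diff)
  have "p * m powr (p - 1) * (x - m) = - (p * (m powr (p - 1) * m))"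
    using True by simp
  also have "\<dots> = - (p * m powr p)"
    by (simp only: eq)
  finally have "p * m powr (p - 1) * (x - m) = - (p * m powr p)" .
  moreover have "1 * m powr p \<le> p * m powr p"
    using assms by (intro mult_right_mono) auto
  moreover have "x powr p = 0"
    using True by simp
  ultimately show ?thesis
    by linarith
next
  case False
  have "p * m powr (p - 1) * (x - m) \<le> x powr p - m powr p"
  proof (rule convex_on_imp_above_tangent[where A = "{0<..}"])
    show "convex_on {0<..} (\<lambda>x::real. x powr p)"
      by (rule convex_on_subset[OF powr_convex]) (use assms in auto)
    show "((\<lambda>x. x powr p) has_real_derivative p * m powr (p - 1)) (at m within {0<..})"
      using assms by (auto intro!: derivative_eq_intros)
  qed (use assms False in \<open>auto simp: interior_open\<close>)
  then show ?thesis by simp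
qed

text \<open>
  Jensen's inequality for the convex function \<open>t \<mapsto> t\<^bsup>p\<^esup>\<close> and the measure \<open>w dM\<close>. It is obtained by
  integrating the tangent line inequality at the mean value \<open>m\<close>, where the linear term drops out.
\<close>

lemma weighted_power_mean:
  fixes w X :: "'a \<Rightarrow> real" and p :: real
  assumes p: "1 \<le> p" and w: "\<And>x. 0 \<le> w x" and X: "\<And>x. 0 \<le> X x"
    and iw: "integrable M w" and i1: "integrable M (\<lambda>x. w x * X x)"
    and ip: "integrable M (\<lambda>x. w x * X x powr p)"
  shows "(LINT x|M. w x * X x) powr p \<le> (LINT x|M. w x) powr (p - 1) * (LINT x|M. w x * X x powr p)"
proof -
  define W where "W = (LINT x|M. w x)"
  define A where "A = (LINT x|M. w x * X x)"
  define B where "B = (LINT x|M. w x * X x powr p)"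
  have W0: "0 \<le> W" and A0: "0 \<le> A" and B0: "0 \<le> B"
    using w X by (auto simp: W_def A_def B_def)
  show ?thesis
  proof (cases "A = 0")
    case True
    then show ?thesis
      using B0 by (simp add: A_def[symmetric] B_def[symmetric])
  next
    case False
    have "W \<noteq> 0"
    proof
      assume "W = 0"
      then have "AE x in M. w x = 0"
        using integral_nonneg_eq_0_iff_AE[OF iw] w by (auto simp: W_def)
      then have "AE x in M. w x * X x = 0"
        by auto
      then have "A = 0"
        using i1 X w unfolding A_def by (subst integral_nonneg_eq_0_iff_AE) auto
      with False show False by simp
    qed
    with False W0 A0 have W: "W > 0" and A: "A > 0" by auto
    define m where "m = A / W"
    have m: "m > 0" using W A by (simp add: m_def)
    have "(LINT x|M. w x * m powr p + p * m powr (p - 1) * (w x * X x - m * w x)) \<le> B"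
      unfolding B_def
    proof (rule integral_mono)
      show "integrable M (\<lambda>x. w x * m powr p + p * m powr (p - 1) * (w x * X x - m * w x))"
        using iw i1 by auto
      show "w x * m powr p + p * m powr (p - 1) * (w x * X x - m * w x) \<le> w x * X x powr p" for x
        using mult_left_mono[OF powr_tangent_le[OF p m X[of x]] w[of x]]
        by (simp add: algebra_simps)
    qed (rule ip)
    also have "(LINT x|M. w x * m powr p + p * m powr (p - 1) * (w x * X x - m * w x))
        = W * m powr p + p * m powr (p - 1) * (A - m * W)"
      using iw i1 by (simp add: W_def A_def)
    also have "\<dots> = W * m powr p"
      using W by (simp add: m_def)
    finally have B: "W * m powr p \<le> B" .
    have "A powr p = W powr (p - 1) * (W * m powr p)"
      using W A by (simp add: m_def powr_divide powr_diff)
    also have "\<dots> \<le> W powr (p - 1) * B"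
      using B by (intro mult_left_mono) auto
    finally show ?thesis
      by (simp add: A_def B_def W_def)
  qed
qed

section \<open>Elementary properties of the Hardy space\<close>

lemma upper_half_plane_scale_iff [simp]:
  "0 < s \<Longrightarrow> of_real s * z \<in> upper_half_plane \<longleftrightarrow> z \<in> upper_half_plane"
  by (auto simp: upper_half_plane_def zero_less_mult_iff)

lemma open_upper_half_plane: "open upper_half_plane"
  unfolding upper_half_plane_def by (rule open_halfspace_Im_gt)

lemma hardy_space_holomorphic: "f \<in> hardy_space p \<Longrightarrow> f holomorphic_on upper_half_plane"
  by (simp add: hardy_space_def)

lemma hardy_space_eq_0: "f \<in> hardy_space p \<Longrightarrow> z \<notin> upper_half_plane \<Longrightarrow> f z = 0"
  by (simp add: hardy_space_def)

lemma borel_measurable_zero_off_half_plane: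
  assumes "f holomorphic_on upper_half_plane" "\<And>z. z \<notin> upper_half_plane \<Longrightarrow> f z = 0"
  shows "f \<in> borel_measurable borel"
proof -
  have "(\<lambda>z. indicator upper_half_plane z *\<^sub>R f z) \<in> borel_measurable borel"
    using assms(1) open_upper_half_plane
    by (intro borel_measurable_continuous_on_indicator holomorphic_on_imp_continuous_on) auto
  also have "(\<lambda>z. indicator upper_half_plane z *\<^sub>R f z) = f"
    using assms(2) by (auto simp: indicator_def)
  finally show ?thesis .
qed

lemma hardy_space_borel_measurable: "f \<in> hardy_space p \<Longrightarrow> f \<in> borel_measurable borel"
  using borel_measurable_zero_off_half_plane hardy_space_holomorphic hardy_space_eq_0 by metis

lemma borel_measurable_Complex [measurable]:
  assumes [measurable]: "g \<in> borel_measurable M" "h \<in> borel_measurable M"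
  shows "(\<lambda>x. Complex (g x) (h x)) \<in> borel_measurable M"
  unfolding Complex_eq by measurable

lemma hardy_mean_nonneg: "0 \<le> hardy_mean p f y"
  by (simp add: hardy_mean_def)

lemma hardy_mean_le_norm:
  "f \<in> hardy_space p \<Longrightarrow> 0 < y \<Longrightarrow> hardy_mean p f y \<le> hardy_norm p f"
  unfolding hardy_norm_def by (rule cSUP_upper) (auto simp: hardy_space_def)

lemma hardy_norm_nonneg: "f \<in> hardy_space p \<Longrightarrow> 0 \<le> hardy_norm p f"
  using hardy_mean_le_norm[of f p 1] hardy_mean_nonneg[of p f 1] by simp

lemma hardy_space_slice:
  assumes "0 < p" "f \<in> hardy_space p" "0 < y"
  shows "integrable lborel (\<lambda>x. norm (f (Complex x y)) powr p)"
    and "(LINT x|lborel. norm (f (Complex x y)) powr p) \<le> hardy_norm p f powr p"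
proof -
  show "integrable lborel (\<lambda>x. norm (f (Complex x y)) powr p)"
    using assms by (simp add: hardy_space_def)
  have "hardy_mean p f y powr p \<le> hardy_norm p f powr p"
    using assms hardy_mean_le_norm hardy_mean_nonneg by (intro powr_mono2) auto
  then show "(LINT x|lborel. norm (f (Complex x y)) powr p) \<le> hardy_norm p f powr p"
    using assms by (simp add: hardy_mean_def powr_powr)
qed

lemma hardy_space_slice_nn:
  assumes "0 < p" "f \<in> hardy_space p" "0 < y"
  shows "(\<integral>\<^sup>+x. ennreal (norm (f (Complex x y)) powr p) \<partial>lborel) \<le> ennreal (hardy_norm p f powr p)"
  using hardy_space_slice[OF assms] by (subst nn_integral_eq_integral) (auto intro: ennreal_leI)

text \<open>
  Membership and a norm bound are obtained together from nonnegative integrals, which need no prior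
  integrability on the horizontal lines.
\<close>

lemma hardy_spaceI:
  assumes p: "0 < p" and hol: "f holomorphic_on upper_half_plane"
    and zero: "\<And>z. z \<notin> upper_half_plane \<Longrightarrow> f z = 0" and K: "0 \<le> K"
    and slice: "\<And>y. 0 < y \<Longrightarrow> (\<integral>\<^sup>+x. ennreal (norm (f (Complex x y)) powr p) \<partial>lborel) \<le> ennreal (K powr p)"
  shows "f \<in> hardy_space p" and "hardy_norm p f \<le> K"
proof -
  have [measurable]: "f \<in> borel_measurable borel"
    using hol zero by (rule borel_measurable_zero_off_half_plane)
  have int: "integrable lborel (\<lambda>x. norm (f (Complex x y)) powr p)" if "0 < y" for y
  proof (rule integrableI_bounded)
    show "(\<integral>\<^sup>+x. ennreal (norm (norm (f (Complex x y)) powr p)) \<partial>lborel) < \<infinity>"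
      using slice[OF that] by (simp add: order_le_less_trans)
  qed measurable
  have mean: "hardy_mean p f y \<le> K" if "0 < y" for y
  proof -
    have "(LINT x|lborel. norm (f (Complex x y)) powr p) \<le> K powr p"
      using slice[OF that] nn_integral_eq_integral[OF int[OF that]] by (simp add: ennreal_le_iff)
    then have "hardy_mean p f y \<le> (K powr p) powr (1 / p)"
      unfolding hardy_mean_def using p by (intro powr_mono2) auto
    then show ?thesis
      using p K by (simp add: powr_powr)
  qed
  show "f \<in> hardy_space p"
    unfolding hardy_space_def using hol zero int mean by (auto intro!: bdd_aboveI[of _ K])
  show "hardy_norm p f \<le> K"
    unfolding hardy_norm_def using mean by (intro cSUP_least) auto
qed

text \<open>
  Norms of multiples and of approximate eigenfunctions are only ever estimated, from above and from
  below, by this pointwise comparison, which avoids the triangle inequality of the Hardy norm.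
\<close>

lemma hardy_space_dominated:
  assumes p: "0 < p" and g: "g \<in> hardy_space p" and c: "0 \<le> c"
    and hol: "f holomorphic_on upper_half_plane"
    and zero: "\<And>z. z \<notin> upper_half_plane \<Longrightarrow> f z = 0"
    and le: "\<And>z. z \<in> upper_half_plane \<Longrightarrow> norm (f z) \<le> c * norm (g z)"
  shows "f \<in> hardy_space p" and "hardy_norm p f \<le> c * hardy_norm p g"
proof -
  have [measurable]: "g \<in> borel_measurable borel"
    using g by (rule hardy_space_borel_measurable)
  have "(\<integral>\<^sup>+x. ennreal (norm (f (Complex x y)) powr p) \<partial>lborel)
      \<le> ennreal ((c * hardy_norm p g) powr p)" if "0 < y" for y
  proof -
    have "(\<integral>\<^sup>+x. ennreal (norm (f (Complex x y)) powr p) \<partial>lborel)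
        \<le> (\<integral>\<^sup>+x. ennreal (c powr p) * ennreal (norm (g (Complex x y)) powr p) \<partial>lborel)"
    proof (rule nn_integral_mono)
      fix x :: real
      have "norm (f (Complex x y)) powr p \<le> (c * norm (g (Complex x y))) powr p"
        using le[of "Complex x y"] that p by (intro powr_mono2) (auto simp: upper_half_plane_def)
      then show "ennreal (norm (f (Complex x y)) powr p)
          \<le> ennreal (c powr p) * ennreal (norm (g (Complex x y)) powr p)"
        using c by (simp add: powr_mult ennreal_mult[symmetric] ennreal_leI)
    qed
    also have "\<dots> = ennreal (c powr p) * (\<integral>\<^sup>+x. ennreal (norm (g (Complex x y)) powr p) \<partial>lborel)"
      by (rule nn_integral_cmult) measurable
    also have "\<dots> \<le> ennreal (c powr p) * ennreal (hardy_norm p g powr p)"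
      using hardy_space_slice_nn[OF p g that] by (rule mult_left_mono) simp
    also have "\<dots> = ennreal ((c * hardy_norm p g) powr p)"
      using c hardy_norm_nonneg[OF g] by (simp add: powr_mult ennreal_mult[symmetric])
    finally show ?thesis .
  qed
  then show "f \<in> hardy_space p" and "hardy_norm p f \<le> c * hardy_norm p g"
    using hardy_spaceI[OF p hol zero, of "c * hardy_norm p g"] c hardy_norm_nonneg[OF g] by auto
qed

lemma hardy_space_cmult:
  assumes p: "0 < p" and f: "f \<in> hardy_space p"
  shows "(\<lambda>z. c * f z) \<in> hardy_space p"
    and "hardy_norm p (\<lambda>z. c * f z) = norm c * hardy_norm p f"
proof -
  have hol: "(\<lambda>z. c * f z) holomorphic_on upper_half_plane"
    using hardy_space_holomorphic[OF f] by (intro holomorphic_intros)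
  note * = hardy_space_dominated[OF p f norm_ge_zero[of c] hol]
  show V: "(\<lambda>z. c * f z) \<in> hardy_space p"
    by (rule *) (auto simp: norm_mult hardy_space_eq_0[OF f])
  have le: "hardy_norm p (\<lambda>z. c * f z) \<le> norm c * hardy_norm p f"
    by (rule *) (auto simp: norm_mult hardy_space_eq_0[OF f])
  show "hardy_norm p (\<lambda>z. c * f z) = norm c * hardy_norm p f"
  proof (cases "c = 0")
    case True
    then show ?thesis using le hardy_norm_nonneg[OF V] by simp
  next
    case False
    have "hardy_norm p f \<le> inverse (norm c) * hardy_norm p (\<lambda>z. c * f z)"
      by (rule hardy_space_dominated[OF p V])
         (use False hardy_space_eq_0[OF f] hardy_space_holomorphic[OF f] in \<open>auto simp: norm_mult field_simps\<close>)
    with le False show ?thesis by (simp add: field_simps)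
  qed
qed

text \<open>
  The crude inequality \<open>(u + v)\<^bsup>p\<^esup> \<le> 2\<^bsup>p\<^esup> (u\<^bsup>p\<^esup> + v\<^bsup>p\<^esup>)\<close> suffices, since this bound
  only has to show that the resolvent is bounded by some constant.
\<close>

lemma hardy_space_add:
  assumes p: "0 < p" and f: "f \<in> hardy_space p" and g: "g \<in> hardy_space p"
    and K: "0 \<le> K" "hardy_norm p f \<le> K" "hardy_norm p g \<le> K"
  shows "(\<lambda>z. f z + g z) \<in> hardy_space p"
    and "hardy_norm p (\<lambda>z. f z + g z) \<le> 2 * 2 powr (1 / p) * K"
proof -
  have [measurable]: "g \<in> borel_measurable borel" "f \<in> borel_measurable borel"
    using f g by (auto intro: hardy_space_borel_measurable)
  have "(\<integral>\<^sup>+x. ennreal (norm (f (Complex x y) + g (Complex x y)) powr p) \<partial>lborel)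
      \<le> ennreal ((2 * 2 powr (1 / p) * K) powr p)" if y: "0 < y" for y
  proof -
    let ?F = "\<lambda>x. ennreal (norm (f (Complex x y)) powr p)"
    let ?G = "\<lambda>x. ennreal (norm (g (Complex x y)) powr p)"
    have "(\<integral>\<^sup>+x. ennreal (norm (f (Complex x y) + g (Complex x y)) powr p) \<partial>lborel)
        \<le> (\<integral>\<^sup>+x. ennreal (2 powr p) * (?F x + ?G x) \<partial>lborel)"
    proof (rule nn_integral_mono)
      fix x :: real
      define u v where "u = norm (f (Complex x y))" and "v = norm (g (Complex x y))"
      have uv: "0 \<le> u" "0 \<le> v" by (auto simp: u_def v_def)
      have "norm (f (Complex x y) + g (Complex x y)) powr p \<le> (2 * max u v) powr p"
        using p norm_triangle_ineq[of "f (Complex x y)" "g (Complex x y)"]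
        by (intro powr_mono2) (auto simp: u_def v_def)
      also have "\<dots> = 2 powr p * max u v powr p"
        using uv by (simp add: powr_mult)
      also have "\<dots> \<le> 2 powr p * (u powr p + v powr p)"
        using uv by (intro mult_left_mono) (auto simp: max_def)
      finally show "ennreal (norm (f (Complex x y) + g (Complex x y)) powr p)
          \<le> ennreal (2 powr p) * (?F x + ?G x)"
        by (simp add: u_def v_def ennreal_mult[symmetric] ennreal_leI flip: ennreal_plus)
    qed
    also have "\<dots> = ennreal (2 powr p) * ((\<integral>\<^sup>+x. ?F x \<partial>lborel) + (\<integral>\<^sup>+x. ?G x \<partial>lborel))"
      by (simp add: nn_integral_cmult nn_integral_add)
    also have "\<dots> \<le> ennreal (2 powr p) * (ennreal (hardy_norm p f powr p) + ennreal (hardy_norm p g powr p))"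
      by (intro mult_left_mono add_mono hardy_space_slice_nn p f g y) simp
    also have "\<dots> \<le> ennreal (2 powr p) * (ennreal (K powr p) + ennreal (K powr p))"
      using p K f g by (intro mult_left_mono add_mono ennreal_leI powr_mono2 hardy_norm_nonneg) auto
    also have "\<dots> = ennreal ((2 * 2 powr (1 / p) * K) powr p)"
      using p K by (simp add: powr_mult powr_powr ennreal_mult[symmetric] flip: ennreal_plus)
    finally show ?thesis .
  qed
  moreover have "(\<lambda>z. f z + g z) holomorphic_on upper_half_plane"
    using f g by (intro holomorphic_intros hardy_space_holomorphic)
  ultimately show "(\<lambda>z. f z + g z) \<in> hardy_space p"
      and "hardy_norm p (\<lambda>z. f z + g z) \<le> 2 * 2 powr (1 / p) * K"
    using hardy_spaceI[OF p, of "\<lambda>z. f z + g z" "2 * 2 powr (1 / p) * K"] K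
    by (auto simp: hardy_space_eq_0[OF f] hardy_space_eq_0[OF g])
qed

section \<open>Pointwise bound for Hardy functions\<close>

lemma continuous_on_hardy_compose:
  assumes "f holomorphic_on upper_half_plane" "continuous_on S g" "\<And>t. t \<in> S \<Longrightarrow> g t \<in> upper_half_plane"
  shows "continuous_on S (\<lambda>t. f (g t))"
  using holomorphic_on_imp_continuous_on[OF assms(1)] assms(2)
  by (rule continuous_on_compose2) (use assms(3) in auto)

text \<open>
  Hoelder's inequality on a horizontal segment, as a case of the power mean inequality.
\<close>

lemma hardy_space_interval_bound:
  assumes p: "1 \<le> p" and f: "f \<in> hardy_space p" and y: "0 < y" and h: "0 \<le> h"
  shows "integral {0..h} (\<lambda>t. norm (f (Complex (x + t) y))) \<le> h powr (1 - 1 / p) * hardy_norm p f"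
proof -
  define X where "X = (\<lambda>t. norm (f (Complex (x + t) y)))"
  define N where "N = hardy_norm p f"
  have N: "0 \<le> N" using hardy_norm_nonneg[OF f] by (simp add: N_def)
  have p0: "0 < p" using p by simp
  have cont: "continuous_on A X" for A
    unfolding X_def Complex_eq using y
    by (intro continuous_intros continuous_on_hardy_compose[OF hardy_space_holomorphic[OF f]])
       (auto simp: upper_half_plane_def)
  have iX: "integrable lborel (\<lambda>t. indicat_real {0..h} t * X t)"
    using borel_integrable_compact[OF compact_Icc cont, of 0 h] by simp
  have iXp: "integrable lborel (\<lambda>t. X t powr p)" "(LINT t|lborel. X t powr p) \<le> N powr p"
    using lborel_integrable_real_affine[OF hardy_space_slice(1)[OF p0 f y], of 1 x]
      lborel_integral_real_affine[of 1 "\<lambda>t. norm (f (Complex t y)) powr p" x]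
      hardy_space_slice(2)[OF p0 f y]
    by (auto simp: X_def N_def)
  have iwXp: "integrable lborel (\<lambda>t. indicat_real {0..h} t * X t powr p)"
    using integrable_mult_indicator[OF _ iXp(1), of "{0..h}"] by simp
  have "(LINT t|lborel. indicat_real {0..h} t * X t) powr p
      \<le> (LINT t|lborel. indicat_real {0..h} t) powr (p - 1) * (LINT t|lborel. indicat_real {0..h} t * X t powr p)"
    using iX iwXp h by (intro weighted_power_mean p) (auto simp: X_def integrable_indicator_iff)
  also have "\<dots> \<le> h powr (p - 1) * N powr p"
  proof (rule mult_mono)
    have "(LINT t|lborel. indicat_real {0..h} t * X t powr p) \<le> (LINT t|lborel. X t powr p)"
      by (rule integral_mono[OF iwXp iXp(1)]) (auto simp: indicator_def)
    with iXp(2) show "(LINT t|lborel. indicat_real {0..h} t * X t powr p) \<le> N powr p" by simp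
  qed (use h in auto)
  finally have le: "(LINT t|lborel. indicat_real {0..h} t * X t) powr p \<le> h powr (p - 1) * N powr p" .
  have nn: "0 \<le> (LINT t|lborel. indicat_real {0..h} t * X t)"
    by (rule Bochner_Integration.integral_nonneg) (auto simp: X_def)
  have "((LINT t|lborel. indicat_real {0..h} t * X t) powr p) powr (1 / p) \<le> (h powr (p - 1) * N powr p) powr (1 / p)"
    using le p0 by (intro powr_mono2) auto
  also have "\<dots> = h powr (1 - 1 / p) * N"
    using N h p0 by (simp add: powr_mult powr_powr diff_divide_distrib)
  also have "((LINT t|lborel. indicat_real {0..h} t * X t) powr p) powr (1 / p)
      = (LINT t|lborel. indicat_real {0..h} t * X t)"
    using nn p0 by (simp add: powr_powr)
  also have "(LINT t|lborel. indicat_real {0..h} t * X t) = integral {0..h} X"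
    using set_borel_integral_eq_integral(2)[of "{0..h}" X] iX
    by (simp add: set_lebesgue_integral_def set_integrable_def)
  finally show ?thesis
    by (simp add: X_def N_def)
qed

text \<open>
  Cauchy's formula for the derivative on the circle of radius \<open>h\<close>, which stays inside the half-plane.
  The circle is written in coordinates so that its horizontal translates are visible.
\<close>

lemma norm_deriv_le_circle_mean:
  assumes f: "f holomorphic_on upper_half_plane" and h: "0 < h" "h < y"
  shows "norm (deriv f (Complex x y))
    \<le> integral {0..1} (\<lambda>\<theta>. norm (f (Complex (x + h * cos (2 * pi * \<theta>)) (y + h * sin (2 * pi * \<theta>))))) / h"
proof -
  define z where "z = Complex x y"
  define P where "P = (\<lambda>\<theta>. Complex (x + h * cos (2 * pi * \<theta>)) (y + h * sin (2 * pi * \<theta>)))"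
  have sub: "cball z h \<subseteq> upper_half_plane"
  proof
    fix u assume "u \<in> cball z h"
    then have "norm (z - u) \<le> h" by (simp add: dist_norm)
    then have "\<bar>Im (z - u)\<bar> \<le> h" using abs_Im_le_cmod order_trans by blast
    then show "u \<in> upper_half_plane" using h by (simp add: z_def upper_half_plane_def)
  qed
  have cont: "continuous_on (cball z h) f"
    by (rule holomorphic_on_imp_continuous_on[OF holomorphic_on_subset[OF f sub]])
  have hol: "f holomorphic_on ball z h"
    using f by (rule holomorphic_on_subset) (use sub ball_subset_cball in blast)
  have P: "circlepath z h \<theta> = P \<theta>" for \<theta>
    by (auto simp: circlepath P_def z_def complex_eq_iff Re_exp Im_exp)
  have PU: "P \<theta> \<in> upper_half_plane" for \<theta>
  proof -
    have "norm (P \<theta> - z) = h"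
      unfolding P[symmetric] using h by (simp add: circlepath norm_mult)
    then show ?thesis using sub by (auto simp: dist_norm norm_minus_commute)
  qed
  have deriv: "deriv f z = 1 / (2 * of_real pi * \<i>) * contour_integral (circlepath z h) (\<lambda>u. f u / (u - z)\<^sup>2)"
    and ci: "(\<lambda>u. f u / (u - z)\<^sup>2) contour_integrable_on circlepath z h"
    using Cauchy_derivative_integral_circlepath[OF cont hol, of z] h by (auto simp: DERIV_imp_deriv)
  have "norm (contour_integral (circlepath z h) (\<lambda>u. f u / (u - z)\<^sup>2))
      \<le> integral {0..1} (\<lambda>\<theta>. 2 * pi / h * norm (f (P \<theta>)))"
    unfolding contour_integral_integral
  proof (rule integral_norm_bound_integral)
    show "(\<lambda>\<theta>. f (circlepath z h \<theta>) / (circlepath z h \<theta> - z)\<^sup>2 * vector_derivative (circlepath z h) (at \<theta>))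
        integrable_on {0..1}"
      using ci by (simp add: contour_integrable_on)
    have "continuous_on {0..1} (\<lambda>\<theta>. f (P \<theta>))"
      by (rule continuous_on_hardy_compose[OF f _ PU]) (auto simp: P_def Complex_eq intro!: continuous_intros)
    then show "(\<lambda>\<theta>. 2 * pi / h * norm (f (P \<theta>))) integrable_on {0..1}"
      by (intro integrable_continuous_interval continuous_intros)
    fix \<theta> :: real assume "\<theta> \<in> {0..1}"
    then have "norm (f (circlepath z h \<theta>) / (circlepath z h \<theta> - z)\<^sup>2 * vector_derivative (circlepath z h) (at \<theta>))
       = norm (f (P \<theta>)) / h\<^sup>2 * (2 * pi * h)"
      using h by (simp add: vector_derivative_circlepath norm_mult norm_divide norm_power P)
         (simp add: P[symmetric] circlepath norm_mult norm_power)
    also have "\<dots> = 2 * pi / h * norm (f (P \<theta>))"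
      using h by (simp add: power2_eq_square)
    finally show "norm (f (circlepath z h \<theta>) / (circlepath z h \<theta> - z)\<^sup>2 * vector_derivative (circlepath z h) (at \<theta>))
        \<le> 2 * pi / h * norm (f (P \<theta>))" by simp
  qed
  then have "norm (deriv f z) \<le> integral {0..1} (\<lambda>\<theta>. 2 * pi / h * norm (f (P \<theta>))) / (2 * pi)"
    unfolding deriv using h by (simp add: norm_mult norm_divide field_simps)
  then show ?thesis
    by (simp add: z_def P_def)
qed

text \<open>
  A one-dimensional Sobolev argument on the segment of length \<open>h = Im z / 2\<close> to the right of \<open>z\<close>:
  \<open>\<bar>f z\<bar>\<close> is at most the mean of \<open>\<bar>f\<bar>\<close> over the segment plus the integral of \<open>\<bar>f'\<bar>\<close> over it, and
  both are controlled by integrals of \<open>\<bar>f\<bar>\<close> over horizontal segments of length \<open>h\<close>.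
\<close>

lemma hardy_space_pointwise_bound:
  assumes p: "1 \<le> p" and f: "f \<in> hardy_space p" and z: "z \<in> upper_half_plane"
  shows "norm (f z) \<le> 4 * Im z powr (- 1 / p) * hardy_norm p f"
proof -
  define x y h N where "x = Re z" and "y = Im z" and "h = y / 2" and "N = hardy_norm p f"
  have zeq: "z = Complex x y" by (simp add: x_def y_def)
  have y: "0 < y" using z by (simp add: y_def upper_half_plane_def)
  then have h: "0 < h" "h < y" by (auto simp: h_def)
  have N: "0 \<le> N" using hardy_norm_nonneg[OF f] by (simp add: N_def)
  note hol = hardy_space_holomorphic[OF f]
  define D where "D = (\<lambda>t. deriv f (Complex (x + t) y))"
  define J where "J = integral {0..h} (\<lambda>t. norm (D t))"
  have U: "Complex t y \<in> upper_half_plane" for t using y by (simp add: upper_half_plane_def)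
  have contD: "continuous_on S D" for S
    unfolding D_def
    by (rule continuous_on_hardy_compose[OF holomorphic_deriv[OF hol open_upper_half_plane]])
       (use y in \<open>auto simp: Complex_eq upper_half_plane_def intro!: continuous_intros\<close>)
  define I where "I = (\<lambda>\<theta>. integral {0..h} (\<lambda>t. norm (f (Complex (x + t + h * cos (2 * pi * \<theta>)) (y + h * sin (2 * pi * \<theta>))))))"
  have pos: "0 < y + h * sin \<theta>" for \<theta>
  proof -
    have "h * (-1) \<le> h * sin \<theta>" using h by (intro mult_left_mono) auto
    then show ?thesis using h by simp
  qed
  have cont2: "continuous_on A (\<lambda>(t, \<theta>). norm (f (Complex (x + t + h * cos (2 * pi * \<theta>)) (y + h * sin (2 * pi * \<theta>)))))" for A
    unfolding case_prod_unfold Complex_eq using pos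
    by (intro continuous_intros continuous_on_hardy_compose[OF hol]) (auto simp: upper_half_plane_def)
  \<comment> \<open>Cauchy's estimate on circles of radius \<open>h\<close>, integrated along the segment: interchanging
    the integrals leaves averages of \<open>f\<close> over horizontal segments only.\<close>
  have J: "J \<le> h powr (- 1 / p) * N"
  proof -
    have "J \<le> integral {0..h} (\<lambda>t. integral {0..1} (\<lambda>\<theta>. norm (f (Complex (x + t + h * cos (2 * pi * \<theta>)) (y + h * sin (2 * pi * \<theta>))))) / h)"
      unfolding J_def
    proof (rule integral_le)
      show "(\<lambda>t. norm (D t)) integrable_on {0..h}"
        by (intro integrable_continuous_interval continuous_intros contD)
      show "(\<lambda>t. integral {0..1} (\<lambda>\<theta>. norm (f (Complex (x + t + h * cos (2 * pi * \<theta>)) (y + h * sin (2 * pi * \<theta>))))) / h)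
          integrable_on {0..h}"
        using integral_continuous_on_param[of "{0..h}" 0 1, OF cont2]
        by (intro integrable_continuous_interval continuous_intros) (use h in auto)
      show "norm (D t) \<le> integral {0..1} (\<lambda>\<theta>. norm (f (Complex (x + t + h * cos (2 * pi * \<theta>)) (y + h * sin (2 * pi * \<theta>))))) / h" for t
        unfolding D_def by (rule norm_deriv_le_circle_mean[OF hol h])
    qed
    also have "\<dots> = integral {0..h} (\<lambda>t. integral {0..1} (\<lambda>\<theta>. norm (f (Complex (x + t + h * cos (2 * pi * \<theta>)) (y + h * sin (2 * pi * \<theta>)))))) / h"
      by simp
    also have "\<dots> = integral {0..1} I / h"
      using integral_swap_continuous[of 0 0 h 1, OF cont2] by (simp add: I_def)
    also have "\<dots> \<le> (h powr (1 - 1 / p) * N) / h"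
    proof (rule divide_right_mono)
      have "integral {0..1} I \<le> integral {0..1} (\<lambda>\<theta>::real. h powr (1 - 1 / p) * N)"
      proof (rule integral_le)
        have "continuous_on (cbox 0 1) I"
          unfolding I_def
          using integral_continuous_on_param[of "cbox 0 1" 0 h, OF continuous_on_swap_args[OF cont2]]
          by simp
        then show "I integrable_on {0..1}"
          by (intro integrable_continuous_interval) simp
        show "I \<theta> \<le> h powr (1 - 1 / p) * N" for \<theta>
          using hardy_space_interval_bound[OF p f pos[of "2 * pi * \<theta>"], of h "x + h * cos (2 * pi * \<theta>)"] h
          by (simp add: I_def N_def add_ac)
      qed (rule integrable_const_ivl)
      then show "integral {0..1} I \<le> h powr (1 - 1 / p) * N" by simp
    qed (use h in simp)
    also have "\<dots> = h powr (- 1 / p) * N"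
      using h by (simp add: powr_diff powr_minus field_simps)
    finally show ?thesis .
  qed
  have pt: "norm (f z) \<le> norm (f (Complex (x + t) y)) + J" if t: "t \<in> {0..h}" for t
  proof -
    have "(D has_integral f (Complex (x + t) y) - f (Complex (x + 0) y)) {0..t}"
    proof (rule fundamental_theorem_of_calculus)
      fix s :: real
      have "(f has_field_derivative D s) (at (Complex (x + s) y))"
        unfolding D_def using hol open_upper_half_plane U by (rule holomorphic_derivI)
      moreover have "((\<lambda>s. Complex (x + s) y) has_vector_derivative 1) (at s within {0..t})"
        unfolding Complex_eq by (auto intro!: derivative_eq_intros)
      ultimately show "((\<lambda>t. f (Complex (x + t) y)) has_vector_derivative D s) (at s within {0..t})"
        using field_vector_diff_chain_within[of "\<lambda>s. Complex (x + s) y" 1 s "{0..t}" f "D s"]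
        by (simp add: o_def has_field_derivative_at_within)
    qed (use t in auto)
    then have "f (Complex (x + t) y) - f z = integral {0..t} D"
      by (simp add: integral_unique zeq)
    also have "norm \<dots> \<le> integral {0..t} (\<lambda>s. norm (D s))"
      by (intro integral_norm_bound_integral integrable_continuous_interval continuous_intros contD) auto
    also have "\<dots> \<le> J"
      unfolding J_def using t
      by (intro integral_subset_le integrable_continuous_interval continuous_intros contD) auto
    finally show ?thesis
      using norm_triangle_ineq2[of "f z" "f (Complex (x + t) y)"] by (simp add: norm_minus_commute)
  qed
  have "h * norm (f z) = integral {0..h} (\<lambda>t. norm (f z))"
    using h by simp
  also have "\<dots> \<le> integral {0..h} (\<lambda>t. norm (f (Complex (x + t) y)) + J)"
  proof (rule integral_le)
    show "(\<lambda>t. norm (f (Complex (x + t) y)) + J) integrable_on {0..h}"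
      using y by (intro integrable_continuous_interval continuous_intros continuous_on_hardy_compose[OF hol])
        (auto simp: Complex_eq upper_half_plane_def intro!: continuous_intros)
  qed (use pt in auto)
  also have "\<dots> = integral {0..h} (\<lambda>t. norm (f (Complex (x + t) y))) + h * J"
  proof -
    have "(\<lambda>t. norm (f (Complex (x + t) y))) integrable_on {0..h}"
      using y by (intro integrable_continuous_interval continuous_intros continuous_on_hardy_compose[OF hol])
        (auto simp: Complex_eq upper_half_plane_def intro!: continuous_intros)
    then show ?thesis using h by (subst integral_add) auto
  qed
  also have "\<dots> \<le> h powr (1 - 1 / p) * N + h * (h powr (- 1 / p) * N)"
    using h hardy_space_interval_bound[OF p f y, of h x] J by (intro add_mono mult_left_mono) (auto simp: N_def)
  also have "\<dots> = h * (2 * h powr (- 1 / p) * N)"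
    using h by (simp add: powr_diff powr_minus field_simps)
  finally have "norm (f z) \<le> 2 * h powr (- 1 / p) * N"
    using h by simp
  also have "h powr (- 1 / p) = 2 powr (1 / p) * y powr (- 1 / p)"
    using y by (simp add: h_def powr_divide powr_minus field_simps)
  also have "2 * (2 powr (1 / p) * y powr (- 1 / p)) * N \<le> 2 * (2 powr 1 * y powr (- 1 / p)) * N"
    using p N by (intro mult_right_mono mult_left_mono powr_mono) auto
  finally show ?thesis by (simp add: y_def N_def)
qed

section \<open>Averages of dilations\<close>

text \<open>
  Differentiation under the integral sign. Local domination of \<open>F\<close> itself is enough: Cauchy's
  inequality on smaller discs turns it into domination of the difference quotients.
\<close>

lemma holomorphic_on_integral:
  fixes F :: "'a \<Rightarrow> complex \<Rightarrow> complex"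
  assumes "open S" and hol: "\<And>s. s \<in> space M \<Longrightarrow> F s holomorphic_on S"
    and meas: "\<And>z. z \<in> S \<Longrightarrow> (\<lambda>s. F s z) \<in> borel_measurable M"
    and dom: "\<And>z. z \<in> S \<Longrightarrow> \<exists>r>0. \<exists>B. ball z r \<subseteq> S \<and> integrable M B \<and>
      (\<forall>s\<in>space M. \<forall>w\<in>ball z r. norm (F s w) \<le> B s)"
  shows "(\<lambda>z. LINT s|M. F s z) holomorphic_on S"
  unfolding holomorphic_on_def
proof
  fix z assume z: "z \<in> S"
  obtain r B where r: "0 < r" "ball z r \<subseteq> S" and B: "integrable M B"
    and FB: "\<And>s w. s \<in> space M \<Longrightarrow> w \<in> ball z r \<Longrightarrow> norm (F s w) \<le> B s"
    using dom[OF z] by blast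
  have int: "integrable M (\<lambda>s. F s w)" if "w \<in> ball z r" for w
  proof (rule Bochner_Integration.integrable_bound[OF B])
    show "AE s in M. norm (F s w) \<le> norm (B s)"
      using FB[OF _ that] by (auto intro!: AE_I2 intro: order_trans[OF _ abs_ge_self])
  qed (use meas r that in auto)
  define \<rho> where "\<rho> = r / 2"
  have \<rho>: "0 < \<rho>" using r by (simp add: \<rho>_def)
  have holb: "F s holomorphic_on ball z r" if "s \<in> space M" for s
    using hol[OF that] r(2) by (rule holomorphic_on_subset)
  have der: "norm (deriv (F s) w) \<le> B s / (\<rho> / 2)" if s: "s \<in> space M" and w: "w \<in> ball z \<rho>" for s w
  proof -
    have sub: "cball w (\<rho> / 2) \<subseteq> ball z r"
    proof
      fix u assume "u \<in> cball w (\<rho> / 2)"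
      then show "u \<in> ball z r"
        using w \<rho> dist_triangle[of z u w] by (simp add: \<rho>_def)
    qed
    have "norm ((deriv ^^ 1) (F s) w) \<le> fact 1 * B s / (\<rho> / 2) ^ 1"
    proof (rule Cauchy_inequality)
      show "F s holomorphic_on ball w (\<rho> / 2)"
        using holb[OF s] by (rule holomorphic_on_subset) (use sub ball_subset_cball in blast)
      show "continuous_on (cball w (\<rho> / 2)) (F s)"
        using holomorphic_on_subset[OF holb[OF s] sub] by (rule holomorphic_on_imp_continuous_on)
      show "norm (F s x) \<le> B s" if "norm (w - x) = \<rho> / 2" for x
        using that sub by (intro FB[OF s]) (auto simp: dist_norm)
    qed (use \<rho> in auto)
    then show ?thesis by simp
  qed
  have quot: "norm ((F s w - F s z) / (w - z)) \<le> B s / (\<rho> / 2)" if s: "s \<in> space M" and w: "w \<in> ball z \<rho> - {z}" for s w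
  proof -
    have "norm (F s w - F s z) \<le> B s / (\<rho> / 2) * norm (w - z)"
    proof (rule field_differentiable_bound[where S = "ball z \<rho>"])
      fix u assume u: "u \<in> ball z \<rho>"
      then show "norm (deriv (F s) u) \<le> B s / (\<rho> / 2)" by (rule der[OF s])
      have "u \<in> ball z r" using u \<rho> by (auto simp: \<rho>_def)
      then show "(F s has_field_derivative deriv (F s) u) (at u within ball z \<rho>)"
        using holomorphic_derivI[OF holb[OF s] open_ball] has_field_derivative_at_within by blast
    qed (use w \<rho> in auto)
    then show ?thesis using w \<rho> by (simp add: norm_divide divide_simps)
  qed
  have zr: "z \<in> ball z r" using r by simp
  have "((\<lambda>w. ((LINT s|M. F s w) - (LINT s|M. F s z)) / (w - z)) \<longlongrightarrow> (LINT s|M. deriv (F s) z)) (at z within ball z \<rho>)"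
    unfolding tendsto_at_iff_sequentially
  proof (intro allI impI)
    fix X :: "nat \<Rightarrow> complex" assume X: "\<forall>i. X i \<in> ball z \<rho> - {z}" and lim: "X \<longlonglongrightarrow> z"
    have Xr: "X i \<in> ball z r" for i
      using X[rule_format, of i] \<rho> by (auto simp: \<rho>_def)
    have conv: "(\<lambda>i. (F s (X i) - F s z) / (X i - z)) \<longlonglongrightarrow> deriv (F s) z" if s: "s \<in> space M" for s
    proof -
      have "(F s has_field_derivative deriv (F s) z) (at z)"
        using holb[OF s] open_ball zr by (rule holomorphic_derivI)
      then have "((\<lambda>w. (F s w - F s z) / (w - z)) \<longlongrightarrow> deriv (F s) z) (at z)"
        by (simp add: has_field_derivative_iff)
      moreover have "filterlim X (at z) sequentially"
        using X lim by (intro filterlim_atI) auto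
      ultimately show ?thesis by (rule filterlim_compose)
    qed
    have m: "(\<lambda>s. (F s (X i) - F s z) / (X i - z)) \<in> borel_measurable M" for i
      using meas[OF z] meas[of "X i"] subsetD[OF r(2) Xr[of i]]
      by (intro borel_measurable_divide borel_measurable_diff) auto
    have "(\<lambda>i. LINT s|M. (F s (X i) - F s z) / (X i - z)) \<longlonglongrightarrow> (LINT s|M. deriv (F s) z)"
    proof (rule integral_dominated_convergence[where w = "\<lambda>s. B s / (\<rho> / 2)"])
      show "(\<lambda>s. deriv (F s) z) \<in> borel_measurable M"
        using m conv by (rule borel_measurable_LIMSEQ_metric)
      show "integrable M (\<lambda>s. B s / (\<rho> / 2))"
        using B by simp
      show "AE s in M. (\<lambda>i. (F s (X i) - F s z) / (X i - z)) \<longlonglongrightarrow> deriv (F s) z"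
        using conv by (rule AE_I2)
      show "AE s in M. norm ((F s (X i) - F s z) / (X i - z)) \<le> B s / (\<rho> / 2)" for i
        using X by (intro AE_I2 quot) auto
    qed (rule m)
    moreover have "(LINT s|M. (F s (X i) - F s z) / (X i - z))
        = ((LINT s|M. F s (X i)) - (LINT s|M. F s z)) / (X i - z)" for i
      unfolding integral_divide_zero using int[OF Xr[of i]] int[OF zr] by (simp only: Bochner_Integration.integral_diff)
    ultimately show "((\<lambda>w. ((LINT s|M. F s w) - (LINT s|M. F s z)) / (w - z)) \<circ> X) \<longlonglongrightarrow> (LINT s|M. deriv (F s) z)"
      by (simp only: o_def)
  qed
  then have "((\<lambda>z. LINT s|M. F s z) has_field_derivative (LINT s|M. deriv (F s) z)) (at z)"
    using \<rho> by (simp add: has_field_derivative_iff at_within_open[of z "ball z \<rho>"])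
  then show "(\<lambda>z. LINT s|M. F s z) field_differentiable (at z within S)"
    unfolding field_differentiable_def using has_field_derivative_at_within by blast
qed

text \<open>
  Averages of dilations are known as Hausdorff operators. The Cesaro operator has the indicator of
  \<open>(0, 1]\<close> as its kernel, and the resolvent adds a multiple of the identity to such an average.
\<close>

definition hausdorff_op :: "(real \<Rightarrow> complex) \<Rightarrow> (complex \<Rightarrow> complex) \<Rightarrow> complex \<Rightarrow> complex" where
  "hausdorff_op k f z = (LINT s|lborel. k s * f (of_real s * z))"

text \<open>
  The weight \<open>s\<^bsup>-1/p\<^esup>\<close> is the norm of the dilation by \<open>s\<close> on the Hardy space. Kernels vanish for
  \<open>s \<le> 0\<close>, so that integrals can be taken over the whole line.
\<close>

definition hardy_kernel :: "real \<Rightarrow> (real \<Rightarrow> complex) \<Rightarrow> bool" where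
  "hardy_kernel p k \<longleftrightarrow> k \<in> borel_measurable borel \<and> (\<forall>s\<le>0. k s = 0) \<and>
     integrable lborel (\<lambda>s. norm (k s) * s powr (- 1 / p))"

definition hardy_kernel_norm :: "real \<Rightarrow> (real \<Rightarrow> complex) \<Rightarrow> real" where
  "hardy_kernel_norm p k = (LINT s|lborel. norm (k s) * s powr (- 1 / p))"

lemma hardy_kernelD:
  assumes "hardy_kernel p k"
  shows "k \<in> borel_measurable borel" "s \<le> 0 \<Longrightarrow> k s = 0"
    "integrable lborel (\<lambda>s. norm (k s) * s powr (- 1 / p))"
  using assms by (auto simp: hardy_kernel_def)

lemma hardy_kernel_norm_nonneg: "0 \<le> hardy_kernel_norm p k"
  unfolding hardy_kernel_norm_def by (rule Bochner_Integration.integral_nonneg) auto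

lemma hausdorff_integrand_bound:
  assumes "1 \<le> p" "f \<in> hardy_space p" "hardy_kernel p k" "z \<in> upper_half_plane"
  shows "norm (k s * f (of_real s * z))
    \<le> 4 * Im z powr (- 1 / p) * hardy_norm p f * (norm (k s) * s powr (- 1 / p))"
proof (cases "0 < s")
  case True
  have "norm (f (of_real s * z)) \<le> 4 * Im (of_real s * z) powr (- 1 / p) * hardy_norm p f"
    using assms True by (intro hardy_space_pointwise_bound) auto
  also have "Im (of_real s * z) powr (- 1 / p) = s powr (- 1 / p) * Im z powr (- 1 / p)"
    using True assms(4) by (simp add: powr_mult upper_half_plane_def)
  finally have "norm (k s) * norm (f (of_real s * z))
      \<le> norm (k s) * (4 * (s powr (- 1 / p) * Im z powr (- 1 / p)) * hardy_norm p f)"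
    by (rule mult_left_mono) simp
  then show ?thesis by (simp add: norm_mult mult_ac)
next
  case False
  then show ?thesis using hardy_kernelD(2)[OF assms(3), of s] by simp
qed

lemma hausdorff_op_eq_0:
  assumes "f \<in> hardy_space p" "hardy_kernel p k" "z \<notin> upper_half_plane"
  shows "k s * f (of_real s * z) = 0" "hausdorff_op k f z = 0"
proof -
  show *: "k s * f (of_real s * z) = 0" for s
    using assms hardy_kernelD(2)[OF assms(2), of s] hardy_space_eq_0[OF assms(1)]
    by (cases "0 < s") auto
  show "hausdorff_op k f z = 0"
    by (simp add: hausdorff_op_def *)
qed

lemma hausdorff_integrable:
  assumes p: "1 \<le> p" and f: "f \<in> hardy_space p" and k: "hardy_kernel p k"
  shows "integrable lborel (\<lambda>s. k s * f (of_real s * z))"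
proof (cases "z \<in> upper_half_plane")
  case True
  have [measurable]: "f \<in> borel_measurable borel" "k \<in> borel_measurable borel"
    using hardy_space_borel_measurable[OF f] hardy_kernelD(1)[OF k] by auto
  show ?thesis
  proof (rule Bochner_Integration.integrable_bound)
    show "integrable lborel (\<lambda>s. 4 * Im z powr (- 1 / p) * hardy_norm p f * (norm (k s) * s powr (- 1 / p)))"
      using hardy_kernelD(3)[OF k] by simp
    show "AE s in lborel. norm (k s * f (of_real s * z))
        \<le> norm (4 * Im z powr (- 1 / p) * hardy_norm p f * (norm (k s) * s powr (- 1 / p)))"
      using hausdorff_integrand_bound[OF p f k True] by (auto intro!: AE_I2 intro: order_trans[OF _ abs_ge_self])
  qed measurable
next
  case False
  then show ?thesis by (simp add: hausdorff_op_eq_0[OF f k])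
qed

lemma hausdorff_op_holomorphic:
  assumes p: "1 \<le> p" and f: "f \<in> hardy_space p" and k: "hardy_kernel p k"
  shows "hausdorff_op k f holomorphic_on upper_half_plane"
proof -
  have [measurable]: "f \<in> borel_measurable borel" "k \<in> borel_measurable borel"
    using hardy_space_borel_measurable[OF f] hardy_kernelD(1)[OF k] by auto
  have "(\<lambda>z. LINT s|lborel. k s * f (of_real s * z)) holomorphic_on upper_half_plane"
  proof (rule holomorphic_on_integral[OF open_upper_half_plane])
    fix s :: real
    show "(\<lambda>z. k s * f (of_real s * z)) holomorphic_on upper_half_plane"
    proof (cases "0 < s")
      case True
      then have "f \<circ> (\<lambda>z. of_real s * z) holomorphic_on upper_half_plane"
        by (intro holomorphic_on_compose_gen[OF _ hardy_space_holomorphic[OF f]] holomorphic_intros) auto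
      then show ?thesis
        by (intro holomorphic_intros) (simp add: o_def)
    qed (simp add: hardy_kernelD(2)[OF k])
  next
    fix z assume z: "z \<in> upper_half_plane"
    define r where "r = Im z / 2"
    have r: "0 < r" using z by (simp add: r_def upper_half_plane_def)
    have Im: "r \<le> Im w" if "w \<in> ball z r" for w
    proof -
      have "\<bar>Im (z - w)\<bar> < r" using that abs_Im_le_cmod[of "z - w"] by (simp add: dist_norm)
      then have "Im z - Im w < r" using abs_ge_self[of "Im (z - w)"] minus_complex.simps(2)[of z w] by linarith
      then show ?thesis by (simp add: r_def)
    qed
    let ?B = "\<lambda>s. 4 * r powr (- 1 / p) * hardy_norm p f * (norm (k s) * s powr (- 1 / p))"
    have "norm (k s * f (of_real s * w)) \<le> ?B s" if w: "w \<in> ball z r" for s w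
    proof -
      have wU: "w \<in> upper_half_plane" using Im[OF w] r by (simp add: upper_half_plane_def)
      have "norm (k s * f (of_real s * w)) \<le> 4 * Im w powr (- 1 / p) * hardy_norm p f * (norm (k s) * s powr (- 1 / p))"
        by (rule hausdorff_integrand_bound[OF p f k wU])
      also have "\<dots> \<le> ?B s"
        using Im[OF w] r p hardy_norm_nonneg[OF f]
        by (intro mult_right_mono mult_left_mono powr_mono2') auto
      finally show ?thesis .
    qed
    moreover have "ball z r \<subseteq> upper_half_plane"
      using Im r by (fastforce simp: upper_half_plane_def)
    ultimately show "\<exists>r>0. \<exists>B. ball z r \<subseteq> upper_half_plane \<and> integrable lborel B \<and>
        (\<forall>s\<in>space lborel. \<forall>w\<in>ball z r. norm (k s * f (of_real s * w)) \<le> B s)"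
      using r hardy_kernelD(3)[OF k] by (intro exI[of _ r] conjI exI[of _ ?B]) auto
  qed measurable
  then show ?thesis by (simp add: hausdorff_op_def[abs_def])
qed

text \<open>
  The power mean inequality is applied to the weight \<open>w s = \<bar>k s\<bar> s\<^bsup>-1/p\<^esup>\<close> and to
  \<open>X s = s\<^bsup>1/p\<^esup> \<bar>f (s z)\<bar>\<close>. The factor \<open>s\<close> that appears in \<open>X\<^bsup>p\<^esup>\<close> is the one that
  a dilation of a horizontal line requires, and \<open>X\<close> is bounded because of the pointwise bound.
\<close>

lemma hausdorff_op_power_mean:
  assumes p: "1 \<le> p" and f: "f \<in> hardy_space p" and k: "hardy_kernel p k" and z: "z \<in> upper_half_plane"
  shows "ennreal (norm (hausdorff_op k f z) powr p)
    \<le> ennreal (hardy_kernel_norm p k powr (p - 1)) *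
      (\<integral>\<^sup>+s. ennreal (norm (k s) * s powr (- 1 / p)) * ennreal (s * norm (f (of_real s * z)) powr p) \<partial>lborel)"
proof -
  have [measurable]: "f \<in> borel_measurable borel" "k \<in> borel_measurable borel"
    using hardy_space_borel_measurable[OF f] hardy_kernelD(1)[OF k] by auto
  define w where "w = (\<lambda>s. norm (k s) * s powr (- 1 / p))"
  define X where "X = (\<lambda>s. s powr (1 / p) * norm (f (of_real s * z)))"
  have w0: "w s = 0" if "s \<le> 0" for s
    using hardy_kernelD(2)[OF k that] by (simp add: w_def)
  have wX: "w s * X s = norm (k s * f (of_real s * z))" for s
  proof (cases "0 < s")
    case True
    then have "s powr (- 1 / p) * s powr (1 / p) = 1"
      by (simp flip: powr_add)
    then show ?thesis
      by (simp add: w_def X_def norm_mult algebra_simps)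
  next
    case False
    then show ?thesis using hardy_kernelD(2)[OF k, of s] by (simp add: w_def)
  qed
  have Xp: "w s * X s powr p = w s * (s * norm (f (of_real s * z)) powr p)" for s
    using p w0[of s] by (cases "0 < s") (auto simp: X_def powr_mult powr_powr)
  define B where "B = 4 * Im z powr (- 1 / p) * hardy_norm p f"
  have B: "0 \<le> B" using hardy_norm_nonneg[OF f] by (simp add: B_def)
  have XB: "X s \<le> B" if "0 < s" for s
  proof -
    have "norm (f (of_real s * z)) \<le> 4 * Im (of_real s * z) powr (- 1 / p) * hardy_norm p f"
      using p f z that by (intro hardy_space_pointwise_bound) auto
    also have "\<dots> = s powr (- 1 / p) * B"
      using that z by (simp add: powr_mult upper_half_plane_def B_def)
    finally have "X s \<le> s powr (1 / p) * (s powr (- 1 / p) * B)"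
      unfolding X_def by (intro mult_left_mono) auto
    also have "\<dots> = B"
      using that by (simp flip: powr_add mult.assoc)
    finally show ?thesis .
  qed
  have iw: "integrable lborel w"
    using hardy_kernelD(3)[OF k] by (simp add: w_def)
  have iwX: "integrable lborel (\<lambda>s. w s * X s)"
    unfolding wX using hausdorff_integrable[OF p f k] by (rule integrable_norm)
  have iwXp: "integrable lborel (\<lambda>s. w s * X s powr p)"
  proof (rule Bochner_Integration.integrable_bound)
    show "integrable lborel (\<lambda>s. B powr p * w s)" using iw by simp
    show "AE s in lborel. norm (w s * X s powr p) \<le> norm (B powr p * w s)"
    proof (rule AE_I2)
      fix s :: real
      show "norm (w s * X s powr p) \<le> norm (B powr p * w s)"
      proof (cases "0 < s")
        case True
        then have "X s powr p \<le> B powr p"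
          using XB[OF True] p by (intro powr_mono2) (auto simp: X_def)
        then show ?thesis by (simp add: abs_mult mult.commute[of "B powr p"] mult_left_mono)
      qed (simp add: w0)
    qed
  qed (simp add: w_def X_def)
  have "norm (hausdorff_op k f z) \<le> (LINT s|lborel. w s * X s)"
    unfolding hausdorff_op_def wX by (rule integral_norm_bound)
  then have "norm (hausdorff_op k f z) powr p \<le> (LINT s|lborel. w s * X s) powr p"
    using p by (intro powr_mono2) auto
  also have "\<dots> \<le> (LINT s|lborel. w s) powr (p - 1) * (LINT s|lborel. w s * X s powr p)"
    using iw iwX iwXp by (intro weighted_power_mean p) (auto simp: w_def X_def)
  finally have "ennreal (norm (hausdorff_op k f z) powr p)
      \<le> ennreal (hardy_kernel_norm p k powr (p - 1)) * ennreal (LINT s|lborel. w s * X s powr p)"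
    by (simp add: hardy_kernel_norm_def w_def ennreal_leI flip: ennreal_mult')
  also have "ennreal (LINT s|lborel. w s * X s powr p) = (\<integral>\<^sup>+s. ennreal (w s * X s powr p) \<partial>lborel)"
    using iwXp by (intro nn_integral_eq_integral[symmetric]) (auto simp: w_def)
  also have "\<dots> = (\<integral>\<^sup>+s. ennreal (w s) * ennreal (s * norm (f (of_real s * z)) powr p) \<partial>lborel)"
    unfolding Xp by (simp add: ennreal_mult' w_def)
  finally show ?thesis by (simp add: w_def)
qed

text \<open>
  Minkowski's integral inequality for dilations. Integrating the power mean inequality over a
  horizontal line and exchanging the integrals leaves, for each \<open>s\<close>, the integral of \<open>\<bar>f\<bar>\<^bsup>p\<^esup>\<close> over
  the line at height \<open>s y\<close>, which the norm of \<open>f\<close> bounds uniformly in \<open>s\<close>.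
\<close>

lemma hausdorff_op_bounded:
  assumes p: "1 \<le> p" and f: "f \<in> hardy_space p" and k: "hardy_kernel p k"
  shows "hausdorff_op k f \<in> hardy_space p"
    and "hardy_norm p (hausdorff_op k f) \<le> hardy_kernel_norm p k * hardy_norm p f"
proof -
  have [measurable]: "f \<in> borel_measurable borel" "k \<in> borel_measurable borel"
    using hardy_space_borel_measurable[OF f] hardy_kernelD(1)[OF k] by auto
  have p0: "0 < p" using p by simp
  define M where "M = hardy_kernel_norm p k"
  define N where "N = hardy_norm p f"
  have M: "0 \<le> M" and N: "0 \<le> N"
    using hardy_kernel_norm_nonneg hardy_norm_nonneg[OF f] by (auto simp: M_def N_def)
  define w where "w = (\<lambda>s. norm (k s) * s powr (- 1 / p))"
  have [measurable]: "w \<in> borel_measurable borel" by (simp add: w_def)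
  have slice: "(\<integral>\<^sup>+x. ennreal (norm (hausdorff_op k f (Complex x y)) powr p) \<partial>lborel) \<le> ennreal ((M * N) powr p)"
    if y: "0 < y" for y
  proof -
    have "(\<integral>\<^sup>+x. ennreal (norm (hausdorff_op k f (Complex x y)) powr p) \<partial>lborel)
        \<le> (\<integral>\<^sup>+x. ennreal (M powr (p - 1)) *
            (\<integral>\<^sup>+s. ennreal (w s) * ennreal (s * norm (f (of_real s * Complex x y)) powr p) \<partial>lborel) \<partial>lborel)"
      unfolding M_def w_def
      using y by (intro nn_integral_mono hausdorff_op_power_mean p f k) (simp add: upper_half_plane_def)
    also have "\<dots> = ennreal (M powr (p - 1)) *
        (\<integral>\<^sup>+x. (\<integral>\<^sup>+s. ennreal (w s) * ennreal (s * norm (f (of_real s * Complex x y)) powr p) \<partial>lborel) \<partial>lborel)"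
      by (rule nn_integral_cmult) measurable
    also have "(\<integral>\<^sup>+x. (\<integral>\<^sup>+s. ennreal (w s) * ennreal (s * norm (f (of_real s * Complex x y)) powr p) \<partial>lborel) \<partial>lborel)
        = (\<integral>\<^sup>+s. (\<integral>\<^sup>+x. ennreal (w s) * ennreal (s * norm (f (of_real s * Complex x y)) powr p) \<partial>lborel) \<partial>lborel)"
      by (rule lborel_pair.Fubini'[symmetric]) measurable
    also have "\<dots> \<le> (\<integral>\<^sup>+s. ennreal (w s) * ennreal (N powr p) \<partial>lborel)"
    proof (rule nn_integral_mono)
      fix s :: real
      show "(\<integral>\<^sup>+x. ennreal (w s) * ennreal (s * norm (f (of_real s * Complex x y)) powr p) \<partial>lborel)
          \<le> ennreal (w s) * ennreal (N powr p)"
      proof (cases "0 < s")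
        case True
        have "(\<integral>\<^sup>+x. ennreal (w s) * ennreal (s * norm (f (of_real s * Complex x y)) powr p) \<partial>lborel)
            = ennreal (w s) * (ennreal s * (\<integral>\<^sup>+x. ennreal (norm (f (of_real s * Complex x y)) powr p) \<partial>lborel))"
          using True by (simp add: nn_integral_cmult ennreal_mult')
        also have "ennreal s * (\<integral>\<^sup>+x. ennreal (norm (f (of_real s * Complex x y)) powr p) \<partial>lborel)
            = (\<integral>\<^sup>+x. ennreal (norm (f (Complex x (s * y))) powr p) \<partial>lborel)"
        proof -
          have "of_real s * Complex x y = Complex (0 + s * x) (s * y)" for x
            by (simp add: complex_eq_iff)
          then show ?thesis
            using nn_integral_real_affine[of "\<lambda>x. ennreal (norm (f (Complex x (s * y))) powr p)" s 0] True
            by simp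
        qed
        also have "\<dots> \<le> ennreal (N powr p)"
          unfolding N_def using True y by (intro hardy_space_slice_nn p0 f) auto
        finally show ?thesis by (simp add: mult_left_mono)
      next
        case False
        then show ?thesis using hardy_kernelD(2)[OF k, of s] by (simp add: w_def)
      qed
    qed
    also have "\<dots> = ennreal M * ennreal (N powr p)"
    proof -
      have "(\<integral>\<^sup>+s. ennreal (w s) \<partial>lborel) = ennreal M"
        unfolding M_def hardy_kernel_norm_def w_def
        using hardy_kernelD(3)[OF k] by (intro nn_integral_eq_integral) auto
      then show ?thesis by (simp add: nn_integral_multc)
    qed
    also have "ennreal (M powr (p - 1)) * (ennreal M * ennreal (N powr p)) = ennreal ((M * N) powr p)"
    proof -
      have "M powr (p - 1) * M = M powr p"
        using M by (simp add: powr_diff)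
      then show ?thesis
        using M N by (simp add: powr_mult flip: ennreal_mult' mult.assoc)
    qed
    finally show ?thesis by (simp add: mult_left_mono)
  qed
  show "hausdorff_op k f \<in> hardy_space p"
    and "hardy_norm p (hausdorff_op k f) \<le> hardy_kernel_norm p k * hardy_norm p f"
    using hardy_spaceI[OF p0 hausdorff_op_holomorphic[OF p f k] hausdorff_op_eq_0(2)[OF f k] _ slice] M N
    by (auto simp: M_def N_def)
qed

text \<open>
  Dilations commute, so this is an exchange of integrals; the product of the two weights dominates
  the integrand.
\<close>

lemma hausdorff_op_commute:
  assumes p: "1 \<le> p" and f: "f \<in> hardy_space p" and k: "hardy_kernel p k" and l: "hardy_kernel p l"
  shows "hausdorff_op k (hausdorff_op l f) z = hausdorff_op l (hausdorff_op k f) z"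
proof (cases "z \<in> upper_half_plane")
  case True
  have [measurable]: "f \<in> borel_measurable borel" "k \<in> borel_measurable borel" "l \<in> borel_measurable borel"
    using hardy_space_borel_measurable[OF f] hardy_kernelD(1)[OF k] hardy_kernelD(1)[OF l] by auto
  define u where "u = (\<lambda>s. norm (k s) * s powr (- 1 / p))"
  define v where "v = (\<lambda>s. norm (l s) * s powr (- 1 / p))"
  define C where "C = 4 * Im z powr (- 1 / p) * hardy_norm p f"
  have [measurable]: "u \<in> borel_measurable borel" "v \<in> borel_measurable borel"
    by (auto simp: u_def v_def)
  have uv: "integrable lborel u" "integrable lborel v" "\<And>s. 0 \<le> u s" "\<And>s. 0 \<le> v s"
    using hardy_kernelD(3)[OF k] hardy_kernelD(3)[OF l] by (auto simp: u_def v_def)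
  have bound: "norm (k s * (l r * f (of_real r * (of_real s * z)))) \<le> C * (u s * v r)" for s r
  proof (cases "0 < s")
    case s: True
    then have "norm (l r * f (of_real r * (of_real s * z)))
        \<le> 4 * Im (of_real s * z) powr (- 1 / p) * hardy_norm p f * v r"
      unfolding v_def using True by (intro hausdorff_integrand_bound p f l) auto
    also have "\<dots> = C * (s powr (- 1 / p) * v r)"
      using s True by (simp add: powr_mult upper_half_plane_def C_def)
    finally have "norm (k s) * norm (l r * f (of_real r * (of_real s * z)))
        \<le> norm (k s) * (C * (s powr (- 1 / p) * v r))"
      by (rule mult_left_mono) simp
    then show ?thesis by (simp add: norm_mult u_def mult_ac)
  next
    case False
    then show ?thesis using hardy_kernelD(2)[OF k, of s] by (simp add: u_def)
  qed
  have "integrable (lborel \<Otimes>\<^sub>M lborel) (\<lambda>(s, r). k s * (l r * f (of_real r * (of_real s * z))))"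
  proof (rule Bochner_Integration.integrable_bound)
    have "integrable (lborel \<Otimes>\<^sub>M lborel) (\<lambda>x. u (fst x) * v (snd x))"
      using uv by (intro lborel_pair.Fubini_integrable) (auto simp: abs_mult)
    then show "integrable (lborel \<Otimes>\<^sub>M lborel) (\<lambda>x. C * (u (fst x) * v (snd x)))"
      by simp
    show "AE x in lborel \<Otimes>\<^sub>M lborel. norm (case x of (s, r) \<Rightarrow> k s * (l r * f (of_real r * (of_real s * z))))
        \<le> norm (C * (u (fst x) * v (snd x)))"
      using bound by (auto intro!: AE_I2 intro: order_trans[OF _ abs_ge_self])
  qed measurable
  then have swap: "(LINT r|lborel. LINT s|lborel. k s * (l r * f (of_real r * (of_real s * z))))
      = (LINT s|lborel. LINT r|lborel. k s * (l r * f (of_real r * (of_real s * z))))"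
    by (rule lborel_pair.Fubini_integral)
  have "hausdorff_op k (hausdorff_op l f) z = (LINT s|lborel. LINT r|lborel. k s * (l r * f (of_real r * (of_real s * z))))"
    by (simp add: hausdorff_op_def)
  also have "\<dots> = (LINT r|lborel. LINT s|lborel. l r * (k s * f (of_real s * (of_real r * z))))"
    unfolding swap[symmetric] by (simp add: mult_ac)
  also have "\<dots> = hausdorff_op l (hausdorff_op k f) z"
    by (simp add: hausdorff_op_def)
  finally show ?thesis .
next
  case False
  then show ?thesis
    using hausdorff_op_eq_0(2)[OF hausdorff_op_bounded(1)[OF p f l] k False]
      hausdorff_op_eq_0(2)[OF hausdorff_op_bounded(1)[OF p f k] l False] by simp
qed

section \<open>Power kernels\<close>

lemma has_bochner_integral_powr_from_0:
  assumes "-1 < (a::real)"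
  shows "has_bochner_integral lborel (\<lambda>s. indicator {0..1} s * s powr a) (1 / (a + 1))"
proof -
  have "((\<lambda>s. s powr a) has_integral 1 / (a + 1)) {0..1}"
    using has_integral_powr_from_0[of a 1] assms by simp
  moreover have "(\<lambda>s. indicat_real {0..1} s * s powr a) = (\<lambda>s. if s \<in> {0..1} then s powr a else 0)"
    by (auto simp: indicator_def)
  ultimately have "((\<lambda>s. indicat_real {0..1} s * s powr a) has_integral 1 / (a + 1)) UNIV"
    by (simp only: has_integral_restrict_UNIV)
  then have "(\<integral>\<^sup>+s. ennreal (indicat_real {0..1} s * s powr a) \<partial>lborel) = ennreal (1 / (a + 1))"
    by (intro nn_integral_has_integral_lborel) auto
  then show ?thesis
    using assms by (intro has_bochner_integral_nn_integral) auto
qed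

lemma integrable_powr_to_inf:
  assumes "(a::real) < -1"
  shows "integrable lborel (\<lambda>s. indicator {1..} s * s powr a)"
proof -
  have "((\<lambda>s. s powr a) has_integral - 1 / (a + 1)) {1..}"
    using has_integral_powr_to_inf[of a 1] assms by simp
  moreover have "(\<lambda>s. indicat_real {1..} s * s powr a) = (\<lambda>s. if s \<in> {1..} then s powr a else 0)"
    by (auto simp: indicator_def)
  ultimately have "((\<lambda>s. indicat_real {1..} s * s powr a) has_integral - 1 / (a + 1)) UNIV"
    by (simp only: has_integral_restrict_UNIV)
  then have "(\<integral>\<^sup>+s. ennreal (indicat_real {1..} s * s powr a) \<partial>lborel) = ennreal (- 1 / (a + 1))"
    by (intro nn_integral_has_integral_lborel) auto
  then show ?thesis
    by (intro integrableI_nn_integral_finite) auto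
qed

text \<open>
  The two useful values of \<open>c\<close> are \<open>0\<close>, which gives \<open>s\<^bsup>-b\<^esup>\<close> on \<open>(0, 1]\<close>, and \<open>1\<close>, which
  gives \<open>- s\<^bsup>-b\<^esup>\<close> on \<open>(1, \<infinity>)\<close>. They correspond to the two choices of the constant of
  integration, at \<open>0\<close> or at \<open>\<infinity>\<close>, when an ordinary differential equation is solved along rays.
\<close>

definition resolvent_kernel :: "real \<Rightarrow> complex \<Rightarrow> real \<Rightarrow> complex" where
  "resolvent_kernel c b s = (if 0 < s then of_real (of_bool (s \<le> 1) - c) * of_real s powr (- b) else 0)"

lemma of_real_powr_exp: "0 < s \<Longrightarrow> of_real s powr b = exp (b * of_real (ln s))" for b :: complex
  by (simp add: powr_def Ln_of_real)

lemma borel_measurable_resolvent_kernel [measurable]: "resolvent_kernel c b \<in> borel_measurable borel"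
proof -
  have "resolvent_kernel c b = (\<lambda>s. if 0 < s then of_real (of_bool (s \<le> 1) - c) * exp (- b * of_real (ln s)) else 0)"
    by (auto simp: resolvent_kernel_def of_real_powr_exp fun_eq_iff)
  also have "\<dots> \<in> borel_measurable borel" by measurable
  finally show ?thesis .
qed

lemma norm_resolvent_kernel:
  "norm (resolvent_kernel c b s) * s powr d = (if 0 < s then \<bar>of_bool (s \<le> 1) - c\<bar> * s powr (d - Re b) else 0)"
proof (cases "0 < s")
  case True
  have "norm (of_real s powr (- b)) * s powr d = s powr (d - Re b)"
    using True by (simp add: norm_powr_real_powr flip: powr_add)
  then show ?thesis
    using True by (simp add: resolvent_kernel_def norm_mult mult.assoc del: of_real_diff)
qed (simp add: resolvent_kernel_def)

lemma resolvent_kernel_near: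
  assumes "Re b < 1 - 1 / p"
  shows "hardy_kernel p (resolvent_kernel 0 b)"
    and "hardy_kernel_norm p (resolvent_kernel 0 b) = 1 / (1 - 1 / p - Re b)"
proof -
  have eq: "(\<lambda>s. norm (resolvent_kernel 0 b s) * s powr (- 1 / p)) = (\<lambda>s. indicator {0..1} s * s powr (- 1 / p - Re b))"
    unfolding norm_resolvent_kernel by (auto simp: fun_eq_iff indicator_def)
  have "has_bochner_integral lborel (\<lambda>s. norm (resolvent_kernel 0 b s) * s powr (- 1 / p)) (1 / (- 1 / p - Re b + 1))"
    unfolding eq using assms by (intro has_bochner_integral_powr_from_0) auto
  then show "hardy_kernel p (resolvent_kernel 0 b)"
    and "hardy_kernel_norm p (resolvent_kernel 0 b) = 1 / (1 - 1 / p - Re b)"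
    by (auto simp: hardy_kernel_def hardy_kernel_norm_def has_bochner_integral_iff resolvent_kernel_def algebra_simps)
qed

lemma resolvent_kernel_far:
  assumes "1 - 1 / p < Re b"
  shows "hardy_kernel p (resolvent_kernel 1 b)"
proof -
  have "integrable lborel (\<lambda>s. norm (resolvent_kernel 1 b s) * s powr (- 1 / p))"
  proof (rule Bochner_Integration.integrable_bound)
    show "integrable lborel (\<lambda>s. indicator {1..} s * s powr (- 1 / p - Re b))"
      using assms by (intro integrable_powr_to_inf) auto
    show "AE s in lborel. norm (norm (resolvent_kernel 1 b s) * s powr (- 1 / p)) \<le> norm (indicator {1..} s * s powr (- 1 / p - Re b))"
      unfolding norm_resolvent_kernel by (auto intro!: AE_I2 simp: indicator_def)
  qed measurable
  then show ?thesis
    by (auto simp: hardy_kernel_def resolvent_kernel_def)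
qed

text \<open>
  Substituting \<open>u = t s\<close> gives \<open>t F (t z) = t\<^bsup>b\<^esup> G t\<close>, where \<open>G\<close> is a primitive of
  \<open>\<psi> u = u\<^bsup>-b\<^esup> f (u z)\<close>; the value of \<open>c\<close> only changes \<open>G\<close> by a constant. The claim is then the
  product rule. It says that \<open>F\<close> solves \<open>(z F)' = b F + f\<close>.
\<close>

lemma resolvent_kernel_ray_derivative:
  assumes p: "1 \<le> p" and f: "f \<in> hardy_space p" and k: "hardy_kernel p (resolvent_kernel c b)"
    and z: "z \<in> upper_half_plane" and t: "0 < t"
  defines "F \<equiv> hausdorff_op (resolvent_kernel c b) f"
  shows "((\<lambda>s. of_real s * F (of_real s * z)) has_vector_derivative
    b * F (of_real t * z) + f (of_real t * z)) (at t)"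
proof -
  define \<psi> where "\<psi> = (\<lambda>u::real. of_real u powr (- b) * f (of_real u * z))"
  define \<Psi> where "\<Psi> = (\<lambda>\<tau> u. if 0 < u then of_real (of_bool (u \<le> \<tau>) - c) * \<psi> u else 0)"
  define G where "G = (\<lambda>\<tau>. LINT u|lborel. \<Psi> \<tau> u)"
  have sub: "of_real \<tau> powr b * \<Psi> \<tau> u
      = resolvent_kernel c b (0 + (1 / \<tau>) * u) * f (of_real (0 + (1 / \<tau>) * u) * (of_real \<tau> * z))"
    if \<tau>: "0 < \<tau>" for \<tau> u
  proof (cases "0 < u")
    case True
    have "of_real (u / \<tau>) powr (- b) = of_real u powr (- b) * of_real \<tau> powr b"
      using True \<tau> by (simp only: of_real_powr_exp divide_pos_pos ln_div)
        (simp add: algebra_simps flip: exp_add)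
    moreover have "of_real (u / \<tau>) * (of_real \<tau> * z) = of_real u * z"
      using \<tau> by simp
    moreover have "u / \<tau> \<le> 1 \<longleftrightarrow> u \<le> \<tau>"
      using \<tau> by simp
    ultimately show ?thesis
      using True \<tau> by (simp add: \<Psi>_def \<psi>_def resolvent_kernel_def mult_ac)
  next
    case False
    then have "\<not> 0 < (1 / \<tau>) * u" using \<tau> by (simp add: zero_less_divide_iff)
    then show ?thesis using False by (simp add: \<Psi>_def resolvent_kernel_def)
  qed
  have \<tau>0: "of_real \<tau> powr b \<noteq> 0" if "0 < \<tau>" for \<tau> :: real
    using that by (simp add: of_real_powr_exp)
  have int: "integrable lborel (\<Psi> \<tau>)" if \<tau>: "0 < \<tau>" for \<tau>
  proof -
    have "integrable lborel (\<lambda>u. of_real \<tau> powr b * \<Psi> \<tau> u)"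
      unfolding sub[OF \<tau>]
      by (rule lborel_integrable_real_affine[OF hausdorff_integrable[OF p f k]]) (use \<tau> in simp)
    then have "integrable lborel (\<lambda>u. inverse (of_real \<tau> powr b) * (of_real \<tau> powr b * \<Psi> \<tau> u))"
      by (rule integrable_mult_right)
    then show ?thesis using \<tau>0[OF \<tau>] by (simp flip: mult.assoc)
  qed
  have FG: "of_real \<tau> * F (of_real \<tau> * z) = of_real \<tau> powr b * G \<tau>" if \<tau>: "0 < \<tau>" for \<tau>
  proof -
    have "F (of_real \<tau> * z) = (1 / \<tau>) *\<^sub>R (LINT u|lborel. of_real \<tau> powr b * \<Psi> \<tau> u)"
      unfolding sub[OF \<tau>] F_def hausdorff_op_def
      using lborel_integral_real_affine[of "1 / \<tau>"
          "\<lambda>s. resolvent_kernel c b s * f (of_real s * (of_real \<tau> * z))" 0] \<tau> by simp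
    then show ?thesis
      using \<tau> by (simp add: G_def scaleR_conv_of_real)
  qed
  have cont: "continuous_on {0<..} \<psi>"
  proof -
    have "continuous_on {0<..} (\<lambda>u::real. f (of_real u * z))"
      by (rule continuous_on_hardy_compose[OF hardy_space_holomorphic[OF f]])
         (use z in \<open>auto intro!: continuous_intros\<close>)
    moreover have "continuous_on {0<..} (\<lambda>u::real. exp (- b * of_real (ln u)))"
      by (intro continuous_intros) auto
    ultimately have "continuous_on {0<..} (\<lambda>u::real. exp (- b * of_real (ln u)) * f (of_real u * z))"
      by (rule continuous_on_mult[rotated])
    moreover have "continuous_on {0<..} \<psi> \<longleftrightarrow>
        continuous_on {0<..} (\<lambda>u::real. exp (- b * of_real (ln u)) * f (of_real u * z))"
      by (rule continuous_on_cong) (auto simp: \<psi>_def of_real_powr_exp)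
    ultimately show ?thesis by simp
  qed
  have incr: "G \<tau> = G \<sigma> + integral {\<sigma>..\<tau>} \<psi>" if \<sigma>: "0 < \<sigma>" "\<sigma> \<le> \<tau>" for \<sigma> \<tau>
  proof -
    have sint: "set_integrable lborel {\<sigma>..\<tau>} \<psi>"
      using \<sigma> by (intro borel_integrable_atLeastAtMost' continuous_on_subset[OF cont]) auto
    have "G \<tau> - G \<sigma> = (LINT u|lborel. \<Psi> \<tau> u - \<Psi> \<sigma> u)"
      using int \<sigma> by (simp add: G_def)
    also have "\<dots> = (LINT u|lborel. indicator {\<sigma>..\<tau>} u *\<^sub>R \<psi> u)"
    proof (rule integral_cong_AE)
      show "AE u in lborel. \<Psi> \<tau> u - \<Psi> \<sigma> u = indicator {\<sigma>..\<tau>} u *\<^sub>R \<psi> u"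
        using AE_lborel_singleton[of \<sigma>]
      proof eventually_elim
        case (elim u)
        then show ?case using \<sigma> by (auto simp: \<Psi>_def indicator_def algebra_simps)
      qed
      show "(\<lambda>u. \<Psi> \<tau> u - \<Psi> \<sigma> u) \<in> borel_measurable lborel"
        using int \<sigma> by (intro borel_measurable_diff borel_measurable_integrable) auto
      show "(\<lambda>u. indicator {\<sigma>..\<tau>} u *\<^sub>R \<psi> u) \<in> borel_measurable lborel"
        using sint unfolding set_integrable_def by (rule borel_measurable_integrable)
    qed
    also have "\<dots> = integral {\<sigma>..\<tau>} \<psi>"
      using set_borel_integral_eq_integral(2)[OF sint] by (simp add: set_lebesgue_integral_def)
    finally show ?thesis by (simp add: algebra_simps)
  qed
  have dG: "(G has_vector_derivative \<psi> t) (at t)"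
  proof -
    have "((\<lambda>\<tau>. integral {t / 2..\<tau>} \<psi>) has_vector_derivative \<psi> t) (at t within {t / 2..2 * t})"
      using t by (intro integral_has_vector_derivative continuous_on_subset[OF cont]) auto
    then have "((\<lambda>\<tau>. G (t / 2) + integral {t / 2..\<tau>} \<psi>) has_vector_derivative \<psi> t) (at t)"
      using t by (auto simp: at_within_Icc_at intro!: derivative_eq_intros)
    then show ?thesis
    proof (rule has_vector_derivative_transform_within_open[of _ _ _ "{t / 2<..<2 * t}"])
      show "G (t / 2) + integral {t / 2..\<tau>} \<psi> = G \<tau>" if "\<tau> \<in> {t / 2<..<2 * t}" for \<tau>
        using that t by (intro incr[symmetric]) auto
    qed (use t in auto)
  qed
  have dp: "((\<lambda>s::real. of_real s powr b) has_vector_derivative b * of_real t powr (b - 1)) (at t)"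
  proof -
    have "((\<lambda>w. w powr b) has_field_derivative b * of_real t powr (b - 1)) (at (of_real t))"
      using t by (intro has_field_derivative_powr) (auto simp: complex_nonpos_Reals_iff)
    then show ?thesis by (rule has_vector_derivative_real_field)
  qed
  have "((\<lambda>s. of_real s powr b * G s) has_vector_derivative of_real t powr b * \<psi> t + b * of_real t powr (b - 1) * G t) (at t)"
    using has_vector_derivative_mult[OF dp dG] .
  also have "of_real t powr b * \<psi> t = f (of_real t * z)"
    using t by (simp add: \<psi>_def powr_minus \<tau>0)
  also have "b * of_real t powr (b - 1) * G t = b * F (of_real t * z)"
  proof -
    have "of_real t powr (b - 1) = of_real t powr b / (of_real t :: complex)"
      using t by (simp add: powr_diff)
    then have "of_real t powr (b - 1) * G t = (of_real t powr b * G t) / of_real t"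
      by simp
    also have "\<dots> = F (of_real t * z)"
      unfolding FG[OF t, symmetric] using t by simp
    finally have "of_real t powr (b - 1) * G t = F (of_real t * z)" .
    then show ?thesis by (simp add: mult.assoc)
  qed
  finally have "((\<lambda>s. of_real s powr b * G s) has_vector_derivative
      b * F (of_real t * z) + f (of_real t * z)) (at t)"
    by (simp only: add.commute)
  then show ?thesis
    by (rule has_vector_derivative_transform_within_open[where S = "{0<..}"]) (use t FG in auto)
qed

section \<open>The Cesaro operator as an average of dilations\<close>

lemma truncated_integral_eq:
  assumes "0 < e" "e < 1"
  shows "truncated_integral f z e = z * integral {e..1} (\<lambda>s. f (of_real s * z))"
proof -
  let ?g = "\<lambda>\<zeta>. f (\<zeta> * z)"
  define Q where "Q = integral {0..1} (\<lambda>x. ?g (linepath (of_real e) 1 x))"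
  have line: "linepath (of_real e * z) z x = linepath (of_real e) 1 x * z" for x
    by (simp add: linepath_def scaleR_conv_of_real algebra_simps)
  have "truncated_integral f z e = z * ((1 - of_real e) * Q)"
  proof -
    have "truncated_integral f z e = integral {0..1} (\<lambda>x. f (linepath (of_real e * z) z x) * (z - of_real e * z))"
      by (simp add: truncated_integral_def contour_integral_integral)
    also have "\<dots> = z * ((1 - of_real e) * Q)"
      unfolding line integral_mult_left by (simp add: Q_def algebra_simps)
    finally show ?thesis .
  qed
  also have "(1 - of_real e) * Q = contour_integral (linepath (of_real e) 1) ?g"
    unfolding contour_integral_integral by (simp add: Q_def mult.commute)
  also have "\<dots> = integral {e..1} (\<lambda>s. f (of_real s * z))"
    using assms by (subst contour_integral_linepath_Reals_eq) auto
  finally show ?thesis .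
qed

text \<open>
  The fundamental theorem of calculus along the ray through \<open>z\<close>. The boundary term
  \<open>e G (e z)\<close> is of order \<open>e\<^bsup>1-1/p\<^esup>\<close> by the pointwise bound.
\<close>

lemma truncated_integral_tendsto:
  assumes p: "1 < p" and G: "G \<in> hardy_space p" and z: "z \<in> upper_half_plane"
    and deriv: "\<And>t. 0 < t \<Longrightarrow>
      ((\<lambda>s. of_real s * G (of_real s * z)) has_vector_derivative f (of_real t * z)) (at t)"
  shows "(truncated_integral f z \<longlongrightarrow> z * G z) (at_right 0)"
proof -
  have eq: "truncated_integral f z e = z * (G z - of_real e * G (of_real e * z))" if e: "0 < e" "e < 1" for e
  proof -
    have "((\<lambda>s. f (of_real s * z)) has_integral of_real 1 * G (of_real 1 * z) - of_real e * G (of_real e * z)) {e..1}"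
      using e deriv by (intro fundamental_theorem_of_calculus) (auto intro: has_vector_derivative_at_within)
    then show ?thesis
      using e by (simp add: truncated_integral_eq integral_unique)
  qed
  define C where "C = 4 * Im z powr (- 1 / p) * hardy_norm p G"
  have "((\<lambda>e. of_real e * G (of_real e * z)) \<longlongrightarrow> 0) (at_right 0)"
  proof (rule Lim_null_comparison)
    show "\<forall>\<^sub>F e in at_right 0. norm (of_real e * G (of_real e * z)) \<le> C * e powr (1 - 1 / p)"
    proof (rule eventually_at_rightI[of 0 1])
      fix e :: real assume e: "e \<in> {0<..<1}"
      have "norm (G (of_real e * z)) \<le> 4 * Im (of_real e * z) powr (- 1 / p) * hardy_norm p G"
        using p e z by (intro hardy_space_pointwise_bound G) auto
      also have "\<dots> = C * e powr (- 1 / p)"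
        using e z by (simp add: powr_mult upper_half_plane_def C_def)
      finally have "e * norm (G (of_real e * z)) \<le> e * (C * e powr (- 1 / p))"
        using e by (intro mult_left_mono) auto
      then show "norm (of_real e * G (of_real e * z)) \<le> C * e powr (1 - 1 / p)"
        using e by (simp add: norm_mult powr_diff powr_minus divide_inverse mult_ac)
    qed simp
    show "((\<lambda>e. C * e powr (1 - 1 / p)) \<longlongrightarrow> 0) (at_right 0)"
      using p by (auto intro!: tendsto_eq_intros simp: eventually_at_filter)
  qed
  then have "((\<lambda>e. z * (G z - of_real e * G (of_real e * z))) \<longlongrightarrow> z * (G z - 0)) (at_right 0)"
    by (intro tendsto_intros)
  moreover have "\<forall>\<^sub>F e in at_right 0. z * (G z - of_real e * G (of_real e * z)) = truncated_integral f z e"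
    using eq by (intro eventually_at_rightI[of 0 1]) auto
  ultimately show ?thesis
    by (simp add: filterlim_cong)
qed

text \<open>
  The Cesaro operator inverts \<open>G \<mapsto> (z G)'\<close>. Both the resolvent equation and the approximate
  eigenfunctions rest on this.
\<close>

lemma cesaro_eqI:
  assumes p: "1 < p" and G: "G \<in> hardy_space p"
    and deriv: "\<And>z t. z \<in> upper_half_plane \<Longrightarrow> 0 < t \<Longrightarrow>
      ((\<lambda>s. of_real s * G (of_real s * z)) has_vector_derivative f (of_real t * z)) (at t)"
  shows "cesaro f = G"
proof
  fix z
  show "cesaro f z = G z"
  proof (cases "z \<in> upper_half_plane")
    case True
    have "Lim (at_right 0) (truncated_integral f z) = z * G z"
      using truncated_integral_tendsto[OF p G True deriv[OF True]]
      by (intro tendsto_Lim) (auto simp: trivial_limit_at_right_real)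
    moreover have "z \<noteq> 0" using True by (auto simp: upper_half_plane_def)
    ultimately show ?thesis using True by (simp add: cesaro_def)
  next
    case False
    then show ?thesis using hardy_space_eq_0[OF G] by (simp add: cesaro_def)
  qed
qed

definition cesaro_kernel :: "real \<Rightarrow> complex" where
  "cesaro_kernel = resolvent_kernel 0 0"

lemma hardy_kernel_cesaro:
  assumes "1 < p"
  shows "hardy_kernel p cesaro_kernel" "hardy_kernel_norm p cesaro_kernel = p / (p - 1)"
  using resolvent_kernel_near[of 0 p] assms by (auto simp: cesaro_kernel_def field_simps)

lemma cesaro_truncated_convergent:
  assumes "1 < p" "f \<in> hardy_space p" "z \<in> upper_half_plane"
  shows "(truncated_integral f z \<longlongrightarrow> z * hausdorff_op cesaro_kernel f z) (at_right 0)"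
  using resolvent_kernel_ray_derivative[of p f 0 0] assms hardy_kernel_cesaro(1)[OF assms(1)]
  by (intro truncated_integral_tendsto hausdorff_op_bounded(1)) (auto simp: cesaro_kernel_def)

lemma cesaro_eq_hausdorff_op:
  assumes "1 < p" "f \<in> hardy_space p"
  shows "cesaro f = hausdorff_op cesaro_kernel f"
  using resolvent_kernel_ray_derivative[of p f 0 0] assms hardy_kernel_cesaro(1)[OF assms(1)]
  by (intro cesaro_eqI hausdorff_op_bounded(1)) (auto simp: cesaro_kernel_def)

section \<open>The resolvent off the circle\<close>

lemma hausdorff_op_add:
  assumes "1 \<le> p" "f \<in> hardy_space p" "g \<in> hardy_space p" "hardy_kernel p k"
  shows "hausdorff_op k (\<lambda>z. f z + g z) = (\<lambda>z. hausdorff_op k f z + hausdorff_op k g z)"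
  using hausdorff_integrable[OF assms(1,2,4)] hausdorff_integrable[OF assms(1,3,4)]
  by (simp add: hausdorff_op_def distrib_left fun_eq_iff)

lemma hausdorff_op_cmult: "hausdorff_op k (\<lambda>z. c * f z) = (\<lambda>z. c * hausdorff_op k f z)"
proof
  fix z
  have "hausdorff_op k (\<lambda>z. c * f z) z = (LINT s|lborel. c * (k s * f (of_real s * z)))"
    by (simp add: hausdorff_op_def mult_ac)
  then show "hausdorff_op k (\<lambda>z. c * f z) z = c * hausdorff_op k f z"
    by (simp add: hausdorff_op_def)
qed

lemma bounded_operator_on_hausdorff_op:
  assumes "1 \<le> p" "hardy_kernel p k"
  shows "bounded_operator_on (hardy_space p) (hardy_norm p) (hausdorff_op k)"
  unfolding bounded_operator_on_def
  using hausdorff_op_bounded[OF assms(1) _ assms(2)] hausdorff_op_add[OF assms(1) _ _ assms(2)]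
    hausdorff_op_cmult by blast

text \<open>
  With \<open>F = R f\<close>, the equation \<open>(z F)' = b F + f\<close> says that \<open>F\<close> is the Cesaro average of
  \<open>b F + f\<close>.
\<close>

lemma resolvent_equation:
  assumes p: "1 < p" and f: "f \<in> hardy_space p" and k: "hardy_kernel p (resolvent_kernel c b)"
  defines "R \<equiv> hausdorff_op (resolvent_kernel c b)" and "C \<equiv> hausdorff_op cesaro_kernel"
  shows "R f z = b * C (R f) z + C f z"
proof -
  have p1: "1 \<le> p" using p by simp
  have Rf: "R f \<in> hardy_space p"
    unfolding R_def by (rule hausdorff_op_bounded(1)[OF p1 f k])
  have bRf: "(\<lambda>z. b * R f z) \<in> hardy_space p"
    using p by (intro hardy_space_cmult(1) Rf) simp
  have sum: "(\<lambda>z. b * R f z + f z) \<in> hardy_space p"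
    using p hardy_norm_nonneg[OF f] by (intro hardy_space_add(1)[OF _ bRf f _ max.cobounded1 max.cobounded2]) auto
  have "cesaro (\<lambda>z. b * R f z + f z) = R f"
    using p Rf unfolding R_def
    by (rule cesaro_eqI) (rule resolvent_kernel_ray_derivative[OF p1 f k])
  then have "C (\<lambda>z. b * R f z + f z) = R f"
    using cesaro_eq_hausdorff_op[OF p sum] by (simp add: C_def)
  then show ?thesis
    using hausdorff_op_add[OF p1 bRf f hardy_kernel_cesaro(1)[OF p]]
    by (simp add: C_def hausdorff_op_cmult) metis
qed

text \<open>
  The Neumann series suggests \<open>S = b + b\<^sup>2 R\<close> as inverse of \<open>w - C\<close> for \<open>b = 1 / w\<close>; both
  compositions reduce to the resolvent equation, one of them after commuting \<open>R\<close> and \<open>C\<close>.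
\<close>

lemma not_in_spectrum_cesaro:
  assumes p: "1 < p" and w: "w \<noteq> 0" and k: "hardy_kernel p (resolvent_kernel c (1 / w))"
  shows "w \<notin> spectrum_on (hardy_space p) (hardy_norm p) cesaro"
proof -
  define b where "b = 1 / w"
  have wb: "w * b = 1" using w by (simp add: b_def)
  have p1: "1 \<le> p" and p0: "0 < p" using p by auto
  note k = k[folded b_def]
  note kC = hardy_kernel_cesaro(1)[OF p]
  define R where "R = hausdorff_op (resolvent_kernel c b)"
  define C where "C = hausdorff_op cesaro_kernel"
  define S where "S = (\<lambda>f z. b * f z + b\<^sup>2 * R f z)"
  have R: "R f \<in> hardy_space p" "hardy_norm p (R f) \<le> hardy_kernel_norm p (resolvent_kernel c b) * hardy_norm p f"
    if "f \<in> hardy_space p" for f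
    using hausdorff_op_bounded[OF p1 that k] by (auto simp: R_def)
  have C: "C f \<in> hardy_space p" "cesaro f = C f" if "f \<in> hardy_space p" for f
    using hausdorff_op_bounded(1)[OF p1 that kC] cesaro_eq_hausdorff_op[OF p that] by (auto simp: C_def)
  have add: "R (\<lambda>z. f z + g z) = (\<lambda>z. R f z + R g z)" "C (\<lambda>z. f z + g z) = (\<lambda>z. C f z + C g z)"
    if "f \<in> hardy_space p" "g \<in> hardy_space p" for f g
    using hausdorff_op_add[OF p1 that k] hausdorff_op_add[OF p1 that kC] by (auto simp: R_def C_def)
  have cmult: "R (\<lambda>z. d * f z) = (\<lambda>z. d * R f z)" "C (\<lambda>z. d * f z) = (\<lambda>z. d * C f z)" for d f
    by (auto simp: R_def C_def hausdorff_op_cmult)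
  have cmV: "(\<lambda>z. d * f z) \<in> hardy_space p" if "f \<in> hardy_space p" for d f
    using hardy_space_cmult(1)[OF p0 that] .
  have res: "R f z = b * C (R f) z + C f z" if "f \<in> hardy_space p" for f z
    unfolding R_def C_def by (rule resolvent_equation[OF p that k])
  have comm: "R (C f) z = C (R f) z" if "f \<in> hardy_space p" for f z
    unfolding R_def C_def by (rule hausdorff_op_commute[OF p1 that k kC])
  have "bounded_operator_on (hardy_space p) (hardy_norm p) S"
    unfolding bounded_operator_on_def
  proof (intro conjI ballI allI)
    define L where "L = norm b + norm (b\<^sup>2) * hardy_kernel_norm p (resolvent_kernel c b)"
    have L: "0 \<le> L" using hardy_kernel_norm_nonneg by (simp add: L_def)
    have S: "S f \<in> hardy_space p \<and> hardy_norm p (S f) \<le> 2 * 2 powr (1 / p) * L * hardy_norm p f"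
      if f: "f \<in> hardy_space p" for f
    proof -
      note N = hardy_norm_nonneg[OF f]
      have 1: "hardy_norm p (\<lambda>z. b * f z) \<le> L * hardy_norm p f"
        using N hardy_kernel_norm_nonneg by (simp add: hardy_space_cmult(2)[OF p0 f] L_def mult_right_mono)
      have "hardy_norm p (\<lambda>z. b\<^sup>2 * R f z) \<le> norm (b\<^sup>2) * (hardy_kernel_norm p (resolvent_kernel c b) * hardy_norm p f)"
        unfolding hardy_space_cmult(2)[OF p0 R(1)[OF f]] using R(2)[OF f] by (rule mult_left_mono) simp
      also have "\<dots> \<le> L * hardy_norm p f"
        unfolding mult.assoc[symmetric] using N by (intro mult_right_mono) (auto simp: L_def)
      finally show ?thesis
        using hardy_space_add[OF p0 cmV[OF f] cmV[OF R(1)[OF f]] _ 1] L N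
        unfolding S_def by (auto simp: mult.assoc)
    qed
    show "S f \<in> hardy_space p" if "f \<in> hardy_space p" for f
      using S[OF that] by simp
    show "\<exists>K. \<forall>f\<in>hardy_space p. hardy_norm p (S f) \<le> K * hardy_norm p f"
      using S by blast
    show "S (\<lambda>z. f z + g z) = (\<lambda>z. S f z + S g z)" if "f \<in> hardy_space p" "g \<in> hardy_space p" for f g
      using add[OF that] by (simp add: S_def algebra_simps)
    show "S (\<lambda>z. d * f z) = (\<lambda>z. d * S f z)" for d f
      using cmult by (simp add: S_def algebra_simps)
  qed
  moreover have "S (\<lambda>z. w * f z - cesaro f z) = f" if f: "f \<in> hardy_space p" for f
  proof
    fix z
    have "R (\<lambda>z. w * f z - C f z) = R (\<lambda>z. w * f z + (-1) * C f z)" by simp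
    also have "\<dots> = (\<lambda>z. w * R f z + (-1) * R (C f) z)"
      unfolding add(1)[OF cmV[OF f] cmV[OF C(1)[OF f]]] cmult ..
    finally have "S (\<lambda>z. w * f z - cesaro f z) z = b * (w * f z - C f z) + b\<^sup>2 * (w * R f z - C (R f) z)"
      using comm[OF f] C(2)[OF f] by (simp add: S_def)
    also have "\<dots> = (w * b) * f z - b * C f z + b * ((w * b) * R f z - b * C (R f) z)"
      by (simp add: algebra_simps power2_eq_square)
    also have "\<dots> = f z - b * C f z + b * (R f z - b * C (R f) z)"
      by (simp only: wb mult_1)
    also have "\<dots> = f z"
      by (subst res[OF f]) (simp add: algebra_simps)
    finally show "S (\<lambda>z. w * f z - cesaro f z) z = f z" .
  qed
  moreover have "(\<lambda>z. w * S f z - cesaro (S f) z) = f" if f: "f \<in> hardy_space p" for f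
  proof
    fix z
    have "S f \<in> hardy_space p"
      using calculation(1) f by (auto simp: bounded_operator_on_def)
    then have "cesaro (S f) z = C (\<lambda>z. b * f z + b\<^sup>2 * R f z) z"
      by (simp add: C(2)) (simp add: S_def)
    also have "\<dots> = b * C f z + b\<^sup>2 * C (R f) z"
      unfolding add(2)[OF cmV[OF f] cmV[OF R(1)[OF f]]] cmult ..
    finally have "w * S f z - cesaro (S f) z = (w * b) * f z - b * C f z + b * ((w * b) * R f z - b * C (R f) z)"
      by (simp add: S_def algebra_simps power2_eq_square)
    also have "\<dots> = f z - b * C f z + b * (R f z - b * C (R f) z)"
      by (simp only: wb mult_1)
    also have "\<dots> = f z"
      by (subst res[OF f]) (simp add: algebra_simps)
    finally show "w * S f z - cesaro (S f) z = f z" .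
  qed
  ultimately show ?thesis
    unfolding spectrum_on_def by blast
qed

section \<open>Approximate eigenfunctions on the circle\<close>

text \<open>
  This is \<open>z\<^bsup>a+\<epsilon>\<^esup> (z + \<i>)\<^bsup>-2\<epsilon>\<^esup>\<close>: the factor \<open>z\<^bsup>\<epsilon>\<^esup>\<close> restores integrability of \<open>z\<^sup>a\<close> at \<open>0\<close>, and the
  other factor restores it at infinity.
\<close>

definition test_function :: "complex \<Rightarrow> real \<Rightarrow> complex \<Rightarrow> complex" where
  "test_function a \<epsilon> z = (if z \<in> upper_half_plane
     then exp ((a + of_real \<epsilon>) * Ln z - of_real (2 * \<epsilon>) * Ln (z + \<i>)) else 0)"

lemma upper_half_plane_nonpos_Reals:
  assumes "z \<in> upper_half_plane"
  shows "z \<notin> \<real>\<^sub>\<le>\<^sub>0" "z + \<i> \<notin> \<real>\<^sub>\<le>\<^sub>0" "z \<noteq> 0" "z + \<i> \<noteq> 0"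
  using assms by (auto simp: upper_half_plane_def complex_nonpos_Reals_iff complex_eq_iff)

lemma test_function_deriv:
  assumes z: "z \<in> upper_half_plane"
  shows "(test_function a \<epsilon> has_field_derivative
    ((a + of_real \<epsilon>) / z - of_real (2 * \<epsilon>) / (z + \<i>)) * test_function a \<epsilon> z) (at z)"
proof (rule has_field_derivative_transform_within_open[OF _ open_upper_half_plane z])
  show "((\<lambda>z. exp ((a + of_real \<epsilon>) * Ln z - of_real (2 * \<epsilon>) * Ln (z + \<i>))) has_field_derivative
      ((a + of_real \<epsilon>) / z - of_real (2 * \<epsilon>) / (z + \<i>)) * test_function a \<epsilon> z) (at z)"
    using upper_half_plane_nonpos_Reals[OF z] z
    by (auto intro!: derivative_eq_intros simp: test_function_def divide_inverse)
qed (simp add: test_function_def)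

lemma test_function_holomorphic: "test_function a \<epsilon> holomorphic_on upper_half_plane"
  unfolding holomorphic_on_open[OF open_upper_half_plane] using test_function_deriv by blast

lemma norm_test_function_le:
  assumes z: "z \<in> upper_half_plane"
  shows "norm (test_function a \<epsilon> z)
    \<le> exp (pi * \<bar>Im a\<bar>) * (norm z powr (Re a + \<epsilon>) * norm (z + \<i>) powr (- 2 * \<epsilon>))"
proof -
  note nz = upper_half_plane_nonpos_Reals[OF z]
  have "- (Im a * Im (Ln z)) \<le> \<bar>Im a\<bar> * \<bar>Im (Ln z)\<bar>"
    by (simp flip: abs_mult)
  also have "\<dots> \<le> \<bar>Im a\<bar> * pi"
    using mpi_less_Im_Ln[OF nz(3)] Im_Ln_le_pi[OF nz(3)] by (intro mult_left_mono) auto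
  finally have le: "- (Im a * Im (Ln z)) \<le> pi * \<bar>Im a\<bar>" by (simp add: mult.commute)
  have "norm (test_function a \<epsilon> z)
      = exp ((Re a + \<epsilon>) * ln (norm z) - Im a * Im (Ln z) - 2 * \<epsilon> * ln (norm (z + \<i>)))"
    using z nz by (simp add: test_function_def)
  also have "\<dots> \<le> exp (pi * \<bar>Im a\<bar> + ((Re a + \<epsilon>) * ln (norm z) + - 2 * \<epsilon> * ln (norm (z + \<i>))))"
    using le by simp
  also have "\<dots> = exp (pi * \<bar>Im a\<bar>) * (norm z powr (Re a + \<epsilon>) * norm (z + \<i>) powr (- 2 * \<epsilon>))"
    using nz by (simp add: powr_def algebra_simps flip: exp_add)
  finally show ?thesis .
qed

text \<open>
  With \<open>\<delta> = \<epsilon> p\<close>, the \<open>p\<close>-th power of the modulus at \<open>x + \<i> y\<close> is at most a constant times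
  \<open>\<bar>x\<bar>\<^bsup>\<delta>-1\<^esup>\<close> for \<open>\<bar>x\<bar> \<le> 1\<close> and \<open>\<bar>x\<bar>\<^bsup>-\<delta>-1\<^esup>\<close> for \<open>\<bar>x\<bar> \<ge> 1\<close>, uniformly in \<open>y\<close>.
  The integrable majorant \<open>q\<close> is the half of this supported on \<open>x \<ge> 0\<close>.
\<close>

lemma test_function_in_hardy_space:
  assumes p: "0 < p" and a: "Re a = - 1 / p" and \<epsilon>: "0 < \<epsilon>" "\<epsilon> * p < 1"
  shows "test_function a \<epsilon> \<in> hardy_space p"
proof -
  define \<delta> where "\<delta> = \<epsilon> * p"
  have \<delta>: "0 < \<delta>" "\<delta> < 1" using p \<epsilon> by (auto simp: \<delta>_def)
  define q where "q = (\<lambda>x::real. indicator {0..1} x * x powr (\<delta> - 1) + indicator {1..} x * x powr (- \<delta> - 1))"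
  define K where "K = exp (pi * \<bar>Im a\<bar>) powr p"
  have q0: "0 \<le> q x" for x by (simp add: q_def)
  have iq: "integrable lborel q"
    unfolding q_def
    by (intro Bochner_Integration.integrable_add integrable_powr_to_inf
        integrable.intros[OF has_bochner_integral_powr_from_0]) (use \<delta> in auto)
  then have iqq: "integrable lborel (\<lambda>x. K * (q x + q (- x)))"
    using lborel_integrable_real_affine[OF iq, of "-1" 0] by simp
  have bound: "norm (test_function a \<epsilon> (Complex x y)) powr p \<le> K * (q x + q (- x))"
    if x: "x \<noteq> 0" and y: "0 < y" for x y
  proof -
    define z where "z = Complex x y"
    have z: "z \<in> upper_half_plane" using y by (simp add: z_def upper_half_plane_def)
    have "norm (test_function a \<epsilon> z) powr p
        \<le> (exp (pi * \<bar>Im a\<bar>) * (norm z powr (Re a + \<epsilon>) * norm (z + \<i>) powr (- 2 * \<epsilon>))) powr p"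
      using p norm_test_function_le[OF z] by (intro powr_mono2) auto
    also have "\<dots> = K * (norm z powr (\<delta> - 1) * norm (z + \<i>) powr (- 2 * \<delta>))"
      using p by (simp add: K_def powr_mult powr_powr a \<delta>_def algebra_simps)
    also have "\<dots> \<le> K * q \<bar>x\<bar>"
    proof (rule mult_left_mono)
      have 1: "norm z powr (\<delta> - 1) \<le> \<bar>x\<bar> powr (\<delta> - 1)"
        using x \<delta> abs_Re_le_cmod[of z] by (intro powr_mono2') (auto simp: z_def)
      show "norm z powr (\<delta> - 1) * norm (z + \<i>) powr (- 2 * \<delta>) \<le> q \<bar>x\<bar>"
      proof (cases "\<bar>x\<bar> \<le> 1")
        case True
        have "1 \<le> norm (z + \<i>)"
          using abs_Im_le_cmod[of "z + \<i>"] y by (simp add: z_def)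
        then have "norm (z + \<i>) powr (- 2 * \<delta>) \<le> 1 powr (- 2 * \<delta>)"
          using \<delta> by (intro powr_mono2') auto
        then have "norm z powr (\<delta> - 1) * norm (z + \<i>) powr (- 2 * \<delta>) \<le> \<bar>x\<bar> powr (\<delta> - 1) * 1"
          using 1 by (intro mult_mono) auto
        also have "\<dots> \<le> q \<bar>x\<bar>"
          using True by (simp add: q_def)
        finally show ?thesis .
      next
        case False
        have "norm (z + \<i>) powr (- 2 * \<delta>) \<le> \<bar>x\<bar> powr (- 2 * \<delta>)"
          using False \<delta> abs_Re_le_cmod[of "z + \<i>"] by (intro powr_mono2') (auto simp: z_def)
        then have "norm z powr (\<delta> - 1) * norm (z + \<i>) powr (- 2 * \<delta>) \<le> \<bar>x\<bar> powr (\<delta> - 1) * \<bar>x\<bar> powr (- 2 * \<delta>)"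
          using 1 by (intro mult_mono) auto
        also have "\<dots> = \<bar>x\<bar> powr (- \<delta> - 1)"
          by (simp flip: powr_add)
        also have "\<dots> \<le> q \<bar>x\<bar>"
          using False by (simp add: q_def)
        finally show ?thesis .
      qed
    qed (simp add: K_def)
    also have "K * q \<bar>x\<bar> \<le> K * (q x + q (- x))"
      using q0[of x] q0[of "- x"] by (intro mult_left_mono) (auto simp: K_def abs_if)
    finally show ?thesis by (simp add: z_def)
  qed
  define J where "J = (LINT x|lborel. K * (q x + q (- x)))"
  have J: "0 \<le> J"
    unfolding J_def using q0 by (intro Bochner_Integration.integral_nonneg) (simp add: K_def)
  have "(\<integral>\<^sup>+x. ennreal (norm (test_function a \<epsilon> (Complex x y)) powr p) \<partial>lborel) \<le> ennreal ((J powr (1 / p)) powr p)"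
    if y: "0 < y" for y
  proof -
    have "(\<integral>\<^sup>+x. ennreal (norm (test_function a \<epsilon> (Complex x y)) powr p) \<partial>lborel)
        \<le> (\<integral>\<^sup>+x. ennreal (K * (q x + q (- x))) \<partial>lborel)"
    proof (rule nn_integral_mono_AE)
      show "AE x in lborel. ennreal (norm (test_function a \<epsilon> (Complex x y)) powr p) \<le> ennreal (K * (q x + q (- x)))"
        using AE_lborel_singleton[of 0] by eventually_elim (use bound y in \<open>auto intro: ennreal_leI\<close>)
    qed
    also have "\<dots> = ennreal J"
      unfolding J_def using q0 by (intro nn_integral_eq_integral iqq AE_I2) (simp add: K_def)
    finally show ?thesis
      using p J by (simp add: powr_powr)
  qed
  then show ?thesis
    using hardy_spaceI(1)[OF p test_function_holomorphic, of a \<epsilon> "J powr (1 / p)"]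
    by (simp add: test_function_def)
qed

lemma hardy_norm_pos:
  assumes p: "1 \<le> p" and f: "f \<in> hardy_space p" and z: "z \<in> upper_half_plane" "f z \<noteq> 0"
  shows "0 < hardy_norm p f"
proof (rule ccontr)
  assume "\<not> 0 < hardy_norm p f"
  then have "hardy_norm p f = 0" using hardy_norm_nonneg[OF f] by simp
  then show False using hardy_space_pointwise_bound[OF p f z(1)] z(2) by simp
qed

text \<open>
  Take \<open>g\<close> to be the test function for \<open>a = c - 1\<close> and \<open>h = (z g)'\<close>. Logarithmic differentiation of
  \<open>g\<close> gives \<open>h = c g + \<eta> m g\<close>, where \<open>m = (\<i> - z) / (z + \<i>)\<close> has modulus at most \<open>1\<close> on the
  half-plane.
\<close>

lemma cesaro_approximate_eigenfunction:
  assumes p: "1 < p" and c: "Re c = 1 - 1 / p" and \<epsilon>: "0 < \<epsilon>"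
  shows "\<exists>g h. g \<in> hardy_space p \<and> h \<in> hardy_space p \<and> 0 < hardy_norm p g \<and> cesaro h = g \<and>
    (\<forall>z. norm (h z - c * g z) \<le> \<epsilon> * norm (g z))"
proof -
  \<comment> \<open>The test function needs \<open>\<eta> p < 1\<close>; a smaller \<open>\<eta>\<close> gives a stronger estimate.\<close>
  define \<eta> where "\<eta> = min \<epsilon> (1 / (2 * p))"
  have \<eta>: "0 < \<eta>" "\<eta> \<le> \<epsilon>" "\<eta> * p < 1"
  proof -
    show "0 < \<eta>" "\<eta> \<le> \<epsilon>" using p \<epsilon> by (auto simp: \<eta>_def)
    have "\<eta> * p \<le> 1 / (2 * p) * p" using p by (intro mult_right_mono) (auto simp: \<eta>_def)
    then show "\<eta> * p < 1" using p by simp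
  qed
  define a where "a = c - 1"
  have p0: "0 < p" and p1: "1 \<le> p" using p by auto
  define g where "g = test_function a \<eta>"
  define h where "h = (\<lambda>z. c * g z + of_real \<eta> * ((\<i> - z) / (z + \<i>)) * g z)"
  have g0: "g z = 0" if "z \<notin> upper_half_plane" for z
    using that by (simp add: g_def test_function_def)
  have gV: "g \<in> hardy_space p"
    unfolding g_def using p0 \<eta> c by (intro test_function_in_hardy_space) (auto simp: a_def)
  have close: "norm (h z - c * g z) \<le> \<eta> * norm (g z)" for z
  proof (cases "z \<in> upper_half_plane")
    case True
    have "norm (\<i> - z) \<le> norm (z + \<i>)"
      using True by (auto simp: cmod_def upper_half_plane_def power2_eq_square algebra_simps)
    then have "norm ((\<i> - z) / (z + \<i>)) \<le> 1"
      using upper_half_plane_nonpos_Reals(4)[OF True] by (simp add: norm_divide divide_simps)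
    then have "\<eta> * norm ((\<i> - z) / (z + \<i>)) * norm (g z) \<le> \<eta> * 1 * norm (g z)"
      using \<eta> by (intro mult_right_mono mult_left_mono) auto
    moreover have "h z - c * g z = of_real \<eta> * ((\<i> - z) / (z + \<i>)) * g z"
      by (simp add: h_def)
    ultimately show ?thesis using \<eta> by (simp only: norm_mult norm_of_real)
  qed (simp add: h_def g0)
  have hV: "h \<in> hardy_space p"
  proof (rule hardy_space_dominated(1)[OF p0 gV])
    show "h holomorphic_on upper_half_plane"
      unfolding h_def g_def using upper_half_plane_nonpos_Reals(4)
      by (intro holomorphic_intros test_function_holomorphic) auto
    show "norm (h z) \<le> (norm c + \<eta>) * norm (g z)" for z
      using norm_triangle_ineq[of "c * g z" "h z - c * g z"] close[of z] by (simp add: norm_mult algebra_simps)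
  qed (use \<eta> g0 in \<open>auto simp: h_def\<close>)
  have "cesaro h = g"
  proof (rule cesaro_eqI[OF p gV])
    fix z :: complex and t :: real assume z: "z \<in> upper_half_plane" and t: "0 < t"
    define \<zeta> where "\<zeta> = of_real t * z"
    have \<zeta>: "\<zeta> \<in> upper_half_plane" using z t by (simp add: \<zeta>_def)
    note nz = upper_half_plane_nonpos_Reals[OF \<zeta>]
    define d where "d = ((a + of_real \<eta>) / \<zeta> - of_real (2 * \<eta>) / (\<zeta> + \<i>)) * g \<zeta>"
    have "(g has_field_derivative d) (at \<zeta>)"
      unfolding g_def d_def by (rule test_function_deriv[OF \<zeta>])
    then have "((\<lambda>w. g (w * z)) has_field_derivative d * z) (at (of_real t))"
      unfolding \<zeta>_def by (rule DERIV_chain2) (auto intro!: derivative_eq_intros)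
    then have "((\<lambda>w. w * g (w * z)) has_field_derivative g \<zeta> + of_real t * (d * z)) (at (of_real t))"
      by (auto intro!: derivative_eq_intros simp: \<zeta>_def)
    then have "((\<lambda>s. of_real s * g (of_real s * z)) has_vector_derivative g \<zeta> + of_real t * (d * z)) (at t)"
      by (rule has_vector_derivative_real_field)
    also have "g \<zeta> + of_real t * (d * z) = g \<zeta> + \<zeta> * d"
      by (simp add: \<zeta>_def)
    also have "\<dots> = h \<zeta>"
    proof -
      have "1 + \<zeta> * ((a + of_real \<eta>) / \<zeta> - of_real (2 * \<eta>) / (\<zeta> + \<i>)) = c + of_real \<eta> * ((\<i> - \<zeta>) / (\<zeta> + \<i>))"
      proof -
        have "(\<i> - \<zeta>) / (\<zeta> + \<i>) = 1 - 2 * \<zeta> / (\<zeta> + \<i>)"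
          using nz(4) by (simp add: diff_divide_eq_iff)
        moreover have "\<zeta> * ((a + of_real \<eta>) / \<zeta> - of_real (2 * \<eta>) / (\<zeta> + \<i>))
            = a + of_real \<eta> - of_real \<eta> * (2 * \<zeta> / (\<zeta> + \<i>))"
          using nz(3) by (simp add: right_diff_distrib)
        ultimately show ?thesis by (simp add: a_def right_diff_distrib)
      qed
      then have "g \<zeta> * (1 + \<zeta> * ((a + of_real \<eta>) / \<zeta> - of_real (2 * \<eta>) / (\<zeta> + \<i>)))
          = g \<zeta> * (c + of_real \<eta> * ((\<i> - \<zeta>) / (\<zeta> + \<i>)))"
        by simp
      then show ?thesis by (simp only: d_def h_def distrib_left mult.commute mult.left_commute mult_1_right mult_1_left)
    qed
    finally show "((\<lambda>s. of_real s * g (of_real s * z)) has_vector_derivative h (of_real t * z)) (at t)"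
      by (simp only: \<zeta>_def)
  qed
  moreover have "0 < hardy_norm p g"
    by (rule hardy_norm_pos[OF p1 gV, of \<i>]) (auto simp: g_def test_function_def upper_half_plane_def)
  moreover have "norm (h z - c * g z) \<le> \<epsilon> * norm (g z)" for z
    using close[of z] \<eta>(2) by (meson order_trans mult_right_mono norm_ge_zero)
  ultimately show ?thesis
    using gV hV by blast
qed

lemma approximate_eigenfunction_norm:
  assumes p: "0 < p" and gV: "g \<in> hardy_space p" and hV: "h \<in> hardy_space p"
    and close: "\<And>z. norm (h z - c * g z) \<le> \<epsilon> * norm (g z)"
  shows "(norm c - \<epsilon>) * hardy_norm p g \<le> hardy_norm p h"
    and "0 \<le> \<epsilon> \<Longrightarrow> hardy_norm p h \<le> (norm c + \<epsilon>) * hardy_norm p g"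
proof -
  note facts = hardy_space_holomorphic hardy_space_eq_0
  show "(norm c - \<epsilon>) * hardy_norm p g \<le> hardy_norm p h"
  proof (cases "\<epsilon> < norm c")
    case True
    have "norm (g z) \<le> inverse (norm c - \<epsilon>) * norm (h z)" for z
    proof -
      have "norm (c * g z) \<le> norm (h z) + \<epsilon> * norm (g z)"
        using norm_triangle_ineq2[of "c * g z" "h z"] close[of z] by (simp add: norm_minus_commute)
      then have "(norm c - \<epsilon>) * norm (g z) \<le> norm (h z)"
        by (simp add: norm_mult algebra_simps)
      then show ?thesis using True by (simp add: field_simps)
    qed
    then have "hardy_norm p g \<le> inverse (norm c - \<epsilon>) * hardy_norm p h"
      using True by (intro hardy_space_dominated(2)[OF p hV]) (auto simp: facts[OF gV])
    then show ?thesis using True by (simp add: field_simps)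
  next
    case False
    then have "(norm c - \<epsilon>) * hardy_norm p g \<le> 0"
      using hardy_norm_nonneg[OF gV] by (simp add: mult_nonpos_nonneg)
    then show ?thesis using hardy_norm_nonneg[OF hV] by linarith
  qed
  assume "0 \<le> \<epsilon>"
  moreover have "norm (h z) \<le> (norm c + \<epsilon>) * norm (g z)" for z
    using norm_triangle_ineq[of "c * g z" "h z - c * g z"] close[of z] by (simp add: norm_mult algebra_simps)
  ultimately show "hardy_norm p h \<le> (norm c + \<epsilon>) * hardy_norm p g"
    by (intro hardy_space_dominated(2)[OF p gV]) (auto simp: facts[OF hV])
qed

section \<open>Spectrum and norm\<close>

text \<open>
  If \<open>w \<noteq> 0\<close>, then \<open>w h - C h = w (h - c g)\<close> with \<open>c = 1 / w\<close> is of size \<open>\<epsilon>\<close>, while \<open>h\<close> is not small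
  compared with \<open>g\<close>; a bounded inverse would contradict this for small \<open>\<epsilon>\<close>. For \<open>w = 0\<close> the
  parameter \<open>c\<close> moves to infinity along the line \<open>Re c = 1 - 1 / p\<close>: then \<open>h\<close> is large compared with
  \<open>C h = g\<close>, which contradicts boundedness of an inverse of \<open>C\<close>.
\<close>

lemma in_spectrum_cesaro:
  assumes p: "1 < p" and w: "w = 0 \<or> Re (1 / w) = 1 - 1 / p"
  shows "w \<in> spectrum_on (hardy_space p) (hardy_norm p) cesaro"
proof (rule ccontr)
  assume "w \<notin> spectrum_on (hardy_space p) (hardy_norm p) cesaro"
  then obtain S where bdd: "bounded_operator_on (hardy_space p) (hardy_norm p) S"
    and inv: "\<And>f. f \<in> hardy_space p \<Longrightarrow> S (\<lambda>z. w * f z - cesaro f z) = f"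
    unfolding spectrum_on_def by blast
  have "\<exists>K. \<forall>f\<in>hardy_space p. hardy_norm p (S f) \<le> K * hardy_norm p f"
    using bdd by (simp add: bounded_operator_on_def)
  then obtain K0 where K0: "\<And>f. f \<in> hardy_space p \<Longrightarrow> hardy_norm p (S f) \<le> K0 * hardy_norm p f"
    by blast
  define K where "K = max K0 0"
  have K: "0 \<le> K" by (simp add: K_def)
  have SK: "hardy_norm p (S f) \<le> K * hardy_norm p f" if "f \<in> hardy_space p" for f
    using K0[OF that] mult_right_mono[OF max.cobounded1[of K0 0] hardy_norm_nonneg[OF that]]
    unfolding K_def by (rule order_trans)
  have p0: "0 < p" using p by simp
  show False
  proof (cases "w = 0")
    case True
    \<comment> \<open>The modulus of \<open>c\<close> exceeds \<open>K + 1\<close>, so \<open>h\<close> exceeds \<open>K\<close> times \<open>g\<close> in norm.\<close>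
    define c where "c = Complex (1 - 1 / p) (K + 2)"
    have "Re c = 1 - 1 / p" by (simp add: c_def)
    then obtain g h where gh: "g \<in> hardy_space p" "h \<in> hardy_space p" "0 < hardy_norm p g" "cesaro h = g"
      "\<And>z. norm (h z - c * g z) \<le> 1 * norm (g z)"
      using cesaro_approximate_eigenfunction[OF p _ zero_less_one] by blast
    have "(norm c - 1) * hardy_norm p g \<le> hardy_norm p h"
      by (rule approximate_eigenfunction_norm(1)[OF p0 gh(1,2,5)])
    also have "hardy_norm p h = hardy_norm p (S (\<lambda>z. (-1) * g z))"
      using inv[OF gh(2)] True gh(4) by simp
    also have "\<dots> \<le> K * hardy_norm p (\<lambda>z. (-1) * g z)"
      by (intro SK hardy_space_cmult p0 gh)
    also have "\<dots> = K * hardy_norm p g"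
      by (subst hardy_space_cmult(2)[OF p0 gh(1)]) simp
    finally have "norm c - 1 \<le> K"
      using gh(3) by simp
    moreover have "K + 2 \<le> norm c"
      using abs_Im_le_cmod[of c] by (simp add: c_def)
    ultimately show False by simp
  next
    case False
    define c where "c = 1 / w"
    have wc: "w * c = 1" using False by (simp add: c_def)
    define D where "D = 1 + K * norm w"
    \<comment> \<open>A bounded inverse forces \<open>\<bar>c\<bar> \<le> \<epsilon> D\<close>, which fails for half of the critical value.\<close>
    define \<epsilon> where "\<epsilon> = norm c / (2 * D)"
    have den: "0 < D" using K by (simp add: D_def add_pos_nonneg)
    have c0: "0 < norm c" using False by (simp add: c_def)
    have \<epsilon>: "0 < \<epsilon>" using den c0 by (simp add: \<epsilon>_def)
    have "Re c = 1 - 1 / p" using w False by (simp add: c_def)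
    then obtain g h where gh: "g \<in> hardy_space p" "h \<in> hardy_space p" "0 < hardy_norm p g" "cesaro h = g"
      "\<And>z. norm (h z - c * g z) \<le> \<epsilon> * norm (g z)"
      using cesaro_approximate_eigenfunction[OF p _ \<epsilon>] by blast
    define u where "u = (\<lambda>z. w * h z - g z)"
    have ueq: "u z = w * (h z - c * g z)" for z
      using wc by (simp add: u_def right_diff_distrib flip: mult.assoc)
    have "norm (u z) \<le> (norm w * \<epsilon>) * norm (g z)" for z
      unfolding ueq norm_mult using mult_left_mono[OF gh(5)[of z], of "norm w"] by (simp add: mult.assoc)
    moreover have "u holomorphic_on upper_half_plane"
      unfolding u_def using gh(1,2) by (intro holomorphic_intros hardy_space_holomorphic)
    moreover have "u z = 0" if "z \<notin> upper_half_plane" for z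
      using that gh(1,2) by (simp add: u_def hardy_space_eq_0)
    ultimately have u: "u \<in> hardy_space p" "hardy_norm p u \<le> (norm w * \<epsilon>) * hardy_norm p g"
      using hardy_space_dominated[OF p0 gh(1), of "norm w * \<epsilon>" u] \<epsilon> by auto
    have "(norm c - \<epsilon>) * hardy_norm p g \<le> hardy_norm p h"
      by (rule approximate_eigenfunction_norm(1)[OF p0 gh(1,2,5)])
    also have "h = S u"
      using inv[OF gh(2)] gh(4) by (simp add: u_def)
    also have "hardy_norm p (S u) \<le> K * ((norm w * \<epsilon>) * hardy_norm p g)"
      using SK[OF u(1)] mult_left_mono[OF u(2) K] by linarith
    finally have "(norm c - \<epsilon>) * hardy_norm p g \<le> (K * norm w * \<epsilon>) * hardy_norm p g"
      by (simp add: mult.assoc)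
    then have "norm c - \<epsilon> \<le> K * norm w * \<epsilon>"
      using gh(3) by (simp only: mult_le_cancel_right_pos)
    then have "norm c \<le> \<epsilon> * D"
      by (simp add: D_def algebra_simps)
    also have "\<dots> = norm c / 2"
      using den by (simp add: \<epsilon>_def)
    finally show False using c0 by simp
  qed
qed

text \<open>
  The upper bound is the norm of the kernel. For the lower bound, approximate eigenfunctions with the
  real value \<open>c = 1 - 1 / p\<close> have \<open>\<parallel>C h\<parallel> / \<parallel>h\<parallel> \<ge> 1 / (c + \<epsilon>)\<close>.
\<close>

lemma cesaro_operator_norm:
  assumes p: "1 < p"
  shows "operator_norm_on (hardy_space p) (hardy_norm p) cesaro = p / (p - 1)"
proof -
  have p0: "0 < p" and p1: "1 \<le> p" using p by auto
  define B where "B = {f \<in> hardy_space p. hardy_norm p f \<le> 1}"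
  have upper: "hardy_norm p (cesaro f) \<le> p / (p - 1)" if "f \<in> B" for f
  proof -
    have "hardy_norm p (cesaro f) \<le> p / (p - 1) * hardy_norm p f"
      using that hausdorff_op_bounded(2)[OF p1 _ hardy_kernel_cesaro(1)[OF p]]
      by (simp add: B_def cesaro_eq_hausdorff_op[OF p] hardy_kernel_cesaro(2)[OF p])
    also have "\<dots> \<le> p / (p - 1) * 1"
      using that p by (intro mult_left_mono) (auto simp: B_def)
    finally show ?thesis by simp
  qed
  have bdd: "bdd_above ((\<lambda>f. hardy_norm p (cesaro f)) ` B)"
    using upper by (auto intro!: bdd_aboveI)
  define M where "M = (SUP f\<in>B. hardy_norm p (cesaro f))"
  define c where "c = 1 - 1 / p"
  have c: "0 < c" using p by (simp add: c_def)
  have lower: "1 / (c + \<epsilon>) \<le> M \<and> B \<noteq> {}" if \<epsilon>: "0 < \<epsilon>" "\<epsilon> < c" for \<epsilon>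
  proof -
    have "Re (of_real c) = 1 - 1 / p" by (simp add: c_def)
    then obtain g h where gh: "g \<in> hardy_space p" "h \<in> hardy_space p" "0 < hardy_norm p g" "cesaro h = g"
      "\<And>z. norm (h z - of_real c * g z) \<le> \<epsilon> * norm (g z)"
      using cesaro_approximate_eigenfunction[OF p _ \<epsilon>(1)] by blast
    have 1: "(c - \<epsilon>) * hardy_norm p g \<le> hardy_norm p h" and 2: "hardy_norm p h \<le> (c + \<epsilon>) * hardy_norm p g"
      using approximate_eigenfunction_norm[OF p0 gh(1,2,5)] c \<epsilon> by auto
    have "0 < (c - \<epsilon>) * hardy_norm p g" using gh(3) \<epsilon> by simp
    then have hpos: "0 < hardy_norm p h" using 1 by linarith
    define d where "d = complex_of_real (1 / hardy_norm p h)"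
    have d: "norm d = 1 / hardy_norm p h" using hpos by (simp add: d_def norm_divide)
    define f where "f = (\<lambda>z. d * h z)"
    have fB: "f \<in> B"
      using hardy_space_cmult[OF p0 gh(2), of d] hpos by (simp add: B_def f_def d)
    then have "f \<in> hardy_space p" by (simp add: B_def)
    then have "cesaro f = (\<lambda>z. d * g z)"
      using gh(2,4) by (simp add: cesaro_eq_hausdorff_op[OF p] f_def hausdorff_op_cmult)
    then have "hardy_norm p (cesaro f) = 1 / hardy_norm p h * hardy_norm p g"
      using hardy_space_cmult(2)[OF p0 gh(1), of d] by (simp add: d)
    moreover have "1 / (c + \<epsilon>) \<le> 1 / hardy_norm p h * hardy_norm p g"
      using 2 hpos c \<epsilon> by (simp add: divide_simps mult.commute)
    moreover have "hardy_norm p (cesaro f) \<le> M"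
      unfolding M_def using fB bdd by (rule cSUP_upper)
    ultimately show ?thesis using fB by auto
  qed
  have "1 / (c + 0) \<le> M"
  proof (rule tendsto_upperbound)
    show "((\<lambda>\<epsilon>. 1 / (c + \<epsilon>)) \<longlongrightarrow> 1 / (c + 0)) (at_right 0)"
      using c by (intro tendsto_intros) auto
    show "\<forall>\<^sub>F \<epsilon> in at_right 0. 1 / (c + \<epsilon>) \<le> M"
      using c lower by (intro eventually_at_rightI[of 0 c]) auto
  qed simp
  moreover have "M \<le> p / (p - 1)"
    unfolding M_def using lower[of "c / 2"] c upper by (intro cSUP_least) auto
  moreover have "1 / (c + 0) = p / (p - 1)"
    using p by (simp add: c_def field_simps)
  ultimately show ?thesis
    by (simp add: operator_norm_on_def M_def B_def)
qed

text \<open>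
  Inversion maps the circle through \<open>0\<close> with centre \<open>r\<close> to a vertical line.
\<close>

lemma circle_through_0_iff:
  fixes w :: complex
  assumes "0 < r"
  shows "norm (w - of_real r) = r \<longleftrightarrow> w = 0 \<or> Re (1 / w) = 1 / (2 * r)"
proof -
  have "norm (w - of_real r) = r \<longleftrightarrow> (norm (w - of_real r))\<^sup>2 = r\<^sup>2"
    using assms by (simp add: power2_eq_iff_nonneg)
  also have "\<dots> \<longleftrightarrow> (Re w)\<^sup>2 + (Im w)\<^sup>2 = 2 * r * Re w"
    unfolding cmod_power2 by (simp add: power2_eq_square algebra_simps)
  also have "\<dots> \<longleftrightarrow> w = 0 \<or> Re (1 / w) = 1 / (2 * r)"
  proof (cases "w = 0")
    case False
    then have "(Re w)\<^sup>2 + (Im w)\<^sup>2 \<noteq> 0"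
      by (simp add: complex_eq_iff)
    then show ?thesis
      using False assms by (simp add: Re_divide field_simps)
  qed simp
  finally show ?thesis .
qed

lemma spectrum_cesaro:
  assumes p: "1 < p"
  shows "w \<in> spectrum_on (hardy_space p) (hardy_norm p) cesaro \<longleftrightarrow> w = 0 \<or> Re (1 / w) = 1 - 1 / p"
proof
  assume w: "w \<in> spectrum_on (hardy_space p) (hardy_norm p) cesaro"
  show "w = 0 \<or> Re (1 / w) = 1 - 1 / p"
  proof (rule ccontr)
    assume "\<not> (w = 0 \<or> Re (1 / w) = 1 - 1 / p)"
    then have "w \<noteq> 0" and "Re (1 / w) < 1 - 1 / p \<or> 1 - 1 / p < Re (1 / w)" by auto
    then show False
      using not_in_spectrum_cesaro[OF p] resolvent_kernel_near(1) resolvent_kernel_far w by blast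
  qed
qed (rule in_spectrum_cesaro[OF p])

theorem theorem3p1:
  fixes p :: real
  assumes "1 < p"
  shows "(\<forall>f\<in>hardy_space p. \<forall>z\<in>upper_half_plane.
            \<exists>l. (truncated_integral f z \<longlongrightarrow> l) (at_right 0))
    \<and> bounded_operator_on (hardy_space p) (hardy_norm p) cesaro
    \<and> operator_norm_on (hardy_space p) (hardy_norm p) cesaro = p / (p - 1)
    \<and> spectrum_on (hardy_space p) (hardy_norm p) cesaro
        = {w :: complex. norm (w - of_real (p / (2 * (p - 1)))) = p / (2 * (p - 1))}"
proof (intro conjI)
  show "\<forall>f\<in>hardy_space p. \<forall>z\<in>upper_half_plane. \<exists>l. (truncated_integral f z \<longlongrightarrow> l) (at_right 0)"
    using cesaro_truncated_convergent[OF assms] by blast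
  have V: "(\<lambda>z. f z + g z) \<in> hardy_space p" if "f \<in> hardy_space p" "g \<in> hardy_space p" for f g
    using assms hardy_norm_nonneg[OF that(1)]
    by (intro hardy_space_add(1)[OF _ that _ max.cobounded1 max.cobounded2]) auto
  show "bounded_operator_on (hardy_space p) (hardy_norm p) cesaro"
    using bounded_operator_on_hausdorff_op[OF _ hardy_kernel_cesaro(1)[OF assms]] assms
    by (auto simp: bounded_operator_on_def cesaro_eq_hausdorff_op[OF assms] V hardy_space_cmult(1))
  show "operator_norm_on (hardy_space p) (hardy_norm p) cesaro = p / (p - 1)"
    by (rule cesaro_operator_norm[OF assms])
  define r where "r = p / (2 * (p - 1))"
  have r: "0 < r" "1 / (2 * r) = 1 - 1 / p"
    using assms by (auto simp: r_def field_simps)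
  show "spectrum_on (hardy_space p) (hardy_norm p) cesaro
      = {w. norm (w - of_real (p / (2 * (p - 1)))) = p / (2 * (p - 1))}"
    unfolding r_def[symmetric] set_eq_iff mem_Collect_eq
    using spectrum_cesaro[OF assms] circle_through_0_iff[OF r(1)] unfolding r(2) by blast
qed

end
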